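(* Let $N\ge1$ and $\beta$ a non-negative integer. For all symmetric polynomials $f,g\in\mathbb{C}[x_1,\dots,x_N]^{S_N}$, $$\langle G_{\mathrm H}f,g\rangle_H^{(\beta+1)}=\langle f,\hat G_{\mathrm H}g\rangle_H^{(\beta)}.$$
   Context: On $\mathbb{C}[x]$: $s_{ij}$ swaps $x_i,x_j$; $D^A_j=\partial_{x_j}+\beta\sum_{k\neq j}\frac{1-s_{jk}}{x_j-x_k}$; $\tilde a^\dagger_j=\frac1{\sqrt2}(-D^A_j+2x_j)$, $\tilde a_j=\frac1{\sqrt2}D^A_j$; $\tilde h^A_j=\tilde a^\dagger_j\tilde a_j+\beta\sum_{k<j}s_{jk}$ (all with parameter $\beta$). Let $\mathcal X=\prod_{i<j}(x_i-x_j)$ (multiplication operator), $\mathcal Y_{\mathrm H}=\prod_{i<j}(\beta-\tilde h^A_i+\tilde h^A_j)$, $\hat{\mathcal Y}_{\mathrm H}=\prod_{i<j}(-\beta-\tilde h^A_i+\tilde h^A_j)$ (the $\tilde h^A_j$ commute), and $G_{\mathrm H}=\mathcal X^{-1}\mathcal Y_{\mathrm H}$, $\hat G_{\mathrm H}=\hat{\mathcal Y}_{\mathrm H}\mathcal X$; $G_{\mathrm H}$ maps symmetric polynomials to symmetric polynomials. The scalar product is $\langle f,g\rangle_H^{(\beta)}=\int_{\mathbb{R}^N}f(x)g(x)(\phi_A^{(\beta)})^2dx_1\cdots dx_N$ with $\phi^{(\beta)}_A=\prod_{j<k}|x_j-x_k|^\beta\prod_{j}e^{-x_j^2/2}$.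 *)

theory Defs
  imports "HOL-Analysis.Analysis" "HOL-Combinatorics.Permutations"
begin

text \<open>Points of R^N are functions nat => real; only coordinates 0..N-1 matter
(index i here corresponds to x_{i+1} in the paper).  Elements of C[x_1..x_N]
are represented by the polynomial functions they induce on R^N (an injective
representation).  Operators act on functions R^N -> C; all formulas are exact
at points with pairwise distinct coordinates (an open set of full measure),
which is all the integrals see.\<close>

type_synonym rfun = "(nat \<Rightarrow> real) \<Rightarrow> complex"

definition poly_fun :: "nat \<Rightarrow> rfun \<Rightarrow> bool" where
  "poly_fun N f \<longleftrightarrow> (\<exists>c :: (nat \<Rightarrow> nat) \<Rightarrow> complex.
      finite {\<alpha>. c \<alpha> \<noteq> 0} \<and> (\<forall>\<alpha>. c \<alpha> \<noteq> 0 \<longrightarrow> (\<forall>i\<ge>N. \<alpha> i = 0)) \<and>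
      (\<forall>x. f x = (\<Sum>\<alpha>\<in>{\<alpha>. c \<alpha> \<noteq> 0}. c \<alpha> * (\<Prod>i<N. complex_of_real (x i) ^ \<alpha> i))))"

definition sym_poly :: "nat \<Rightarrow> rfun \<Rightarrow> bool" where
  "sym_poly N f \<longleftrightarrow> poly_fun N f \<and>
     (\<forall>\<sigma>. \<sigma> permutes {..<N} \<longrightarrow> (\<forall>x. f (x \<circ> \<sigma>) = f x))"

definition swapv :: "nat \<Rightarrow> nat \<Rightarrow> (nat \<Rightarrow> real) \<Rightarrow> (nat \<Rightarrow> real)" where
  "swapv i j x = x(i := x j, j := x i)"

definition sw :: "nat \<Rightarrow> nat \<Rightarrow> rfun \<Rightarrow> rfun" where
  "sw i j f = (\<lambda>x. f (swapv i j x))"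

definition pd :: "nat \<Rightarrow> rfun \<Rightarrow> rfun" where
  "pd j f = (\<lambda>x. vector_derivative (\<lambda>t. f (x(j := t))) (at (x j)))"

definition DA :: "nat \<Rightarrow> real \<Rightarrow> nat \<Rightarrow> rfun \<Rightarrow> rfun" where
  "DA N b j f = (\<lambda>x. pd j f x + complex_of_real b *
      (\<Sum>k\<in>{..<N} - {j}. (f x - sw j k f x) / complex_of_real (x j - x k)))"

definition adag :: "nat \<Rightarrow> real \<Rightarrow> nat \<Rightarrow> rfun \<Rightarrow> rfun" where
  "adag N b j f = (\<lambda>x. (- DA N b j f x + 2 * complex_of_real (x j) * f x) / complex_of_real (sqrt 2))"

definition aop :: "nat \<Rightarrow> real \<Rightarrow> nat \<Rightarrow> rfun \<Rightarrow> rfun" where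
  "aop N b j f = (\<lambda>x. DA N b j f x / complex_of_real (sqrt 2))"

definition hA :: "nat \<Rightarrow> real \<Rightarrow> nat \<Rightarrow> rfun \<Rightarrow> rfun" where
  "hA N b j f = (\<lambda>x. adag N b j (aop N b j f) x + complex_of_real b * (\<Sum>k<j. sw j k f x))"

definition yfactor :: "nat \<Rightarrow> real \<Rightarrow> real \<Rightarrow> nat \<Rightarrow> nat \<Rightarrow> rfun \<Rightarrow> rfun" where
  "yfactor N b c i j f = (\<lambda>x. complex_of_real c * f x - hA N b i f x + hA N b j f x)"

definition index_pairs :: "nat \<Rightarrow> (nat \<times> nat) list" where
  "index_pairs N = concat (map (\<lambda>i. map (\<lambda>j. (i, j)) [Suc i..<N]) [0..<N])"

(* prod_{i<j} (c - h_i + h_j), composition of commuting operators *)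
definition Yop :: "nat \<Rightarrow> real \<Rightarrow> real \<Rightarrow> rfun \<Rightarrow> rfun" where
  "Yop N b c = foldr (\<lambda>(i, j) T. yfactor N b c i j \<circ> T) (index_pairs N) id"

definition vandermonde :: "nat \<Rightarrow> (nat \<Rightarrow> real) \<Rightarrow> real" where
  "vandermonde N x = (\<Prod>i<N. \<Prod>j\<in>{i<..<N}. (x i - x j))"

definition GH :: "nat \<Rightarrow> real \<Rightarrow> rfun \<Rightarrow> rfun" where
  "GH N b f = (\<lambda>x. Yop N b b f x / complex_of_real (vandermonde N x))"

definition GHhat :: "nat \<Rightarrow> real \<Rightarrow> rfun \<Rightarrow> rfun" where
  "GHhat N b g = Yop N b (- b) (\<lambda>x. complex_of_real (vandermonde N x) * g x)"

definition phiA :: "nat \<Rightarrow> nat \<Rightarrow> (nat \<Rightarrow> real) \<Rightarrow> real" where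
  "phiA N b x = (\<Prod>j<N. \<Prod>k\<in>{j<..<N}. \<bar>x j - x k\<bar> ^ b) * (\<Prod>j<N. exp (- (x j)\<^sup>2 / 2))"

definition ipH :: "nat \<Rightarrow> nat \<Rightarrow> rfun \<Rightarrow> rfun \<Rightarrow> complex" where
  "ipH N b f g = (\<integral>x. f x * g x * complex_of_real ((phiA N b x)\<^sup>2) \<partial>(Pi\<^sub>M {..<N} (\<lambda>_. lborel)))"

end

theory Submission
  imports Defs "HOL-Probability.Distributions"
begin

text \<open>
  Since \<open>(\<phi>\<^sub>A)\<^sup>2\<close> is \<open>\<Delta>\<^bsup>2\<beta>\<^esup>\<close> times a Gaussian, one factor \<open>\<Delta>\<close> of the weight cancels
  the division in \<open>G\<^sub>H\<close>, and the claim becomes \<open>\<langle>Y f, \<Delta> g\<rangle> = \<langle>f, Y' (\<Delta> g)\<rangle>\<close> in the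
  \<open>\<beta>\<close>-pairing on polynomials, with \<open>f\<close> symmetric and \<open>u = \<Delta> g\<close> antisymmetric.  Integration by parts
  makes each \<open>h\<^sub>j\<close> self-adjoint, so it remains to compare the reversed product \<open>Y\<close> with \<open>Y'\<close> on \<open>u\<close>.
  Put \<open>H\<^sub>j = x\<^sub>j D\<^sub>j - D\<^sub>j\<^sup>2 / 2\<close>; then \<open>h\<^sub>j\<close> equals \<open>H\<^sub>j\<close> up to transpositions,
  \<open>s\<^sub>i\<^sub>j\<close> permutes the \<open>H\<^sub>k\<close>, and \<open>[H\<^sub>i, H\<^sub>j] = \<beta> (H\<^sub>j - H\<^sub>i) s\<^sub>i\<^sub>j\<close>.  Hence the two products
  applied to \<open>u\<close> agree up to words in the \<open>H\<^sub>k\<close> of length less than \<open>N (N - 1) / 2\<close>.  Such a word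
  has two letters of equal multiplicity; interchanging them does not change the word up to shorter ones, but
  changes the sign of its pairing with \<open>f\<close>, so by induction on the length this pairing vanishes.
\<close>

hide_const (open) Finite_Cartesian_Product.transpose
hide_fact (open) Finite_Cartesian_Product.transpose_def

section \<open>Polynomial functions as a ring\<close>

inductive_set polys :: "rfun set" where
  const: "(\<lambda>x. c) \<in> polys"
| coord: "(\<lambda>x. complex_of_real (x i)) \<in> polys"
| add: "f \<in> polys \<Longrightarrow> g \<in> polys \<Longrightarrow> (\<lambda>x. f x + g x) \<in> polys"
| mult: "f \<in> polys \<Longrightarrow> g \<in> polys \<Longrightarrow> (\<lambda>x. f x * g x) \<in> polys"

lemma polys_uminus: "f \<in> polys \<Longrightarrow> (\<lambda>x. - f x) \<in> polys"
  using polys.mult[OF polys.const[of "-1"], of f] by simp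

lemma polys_diff: "f \<in> polys \<Longrightarrow> g \<in> polys \<Longrightarrow> (\<lambda>x. f x - g x) \<in> polys"
  using polys.add[OF _ polys_uminus, of f g] by simp

lemma polys_sum: "(\<And>i. i \<in> A \<Longrightarrow> f i \<in> polys) \<Longrightarrow> (\<lambda>x. \<Sum>i\<in>A. f i x) \<in> polys"
  by (induction A rule: infinite_finite_induct) (auto intro: polys.intros)

lemma polys_prod: "(\<And>i. i \<in> A \<Longrightarrow> f i \<in> polys) \<Longrightarrow> (\<lambda>x. \<Prod>i\<in>A. f i x) \<in> polys"
  by (induction A rule: infinite_finite_induct) (auto intro: polys.intros)

lemma polys_power: "f \<in> polys \<Longrightarrow> (\<lambda>x. f x ^ n) \<in> polys"
  by (induction n) (auto intro: polys.intros)

lemma polys_swap: "f \<in> polys \<Longrightarrow> sw i j f \<in> polys"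
proof (induction rule: polys.induct)
  case (coord k)
  show ?case
    by (cases "k = j"; cases "k = i") (simp_all add: sw_def swapv_def polys.coord)
qed (auto simp: sw_def intro: polys.intros)

lemma polys_vector_derivative:
  "f \<in> polys \<Longrightarrow>
    \<exists>d\<in>polys. \<forall>x. ((\<lambda>t. f (x(j := t))) has_vector_derivative d x) (at (x j))"
proof (induction rule: polys.induct)
  case (const c)
  show ?case by (rule bexI[of _ "\<lambda>x. 0"]) (auto intro: polys.const)
next
  case (coord i)
  show ?case
  proof (rule bexI[of _ "\<lambda>x. if i = j then 1 else 0"])
    show "\<forall>x. ((\<lambda>t. complex_of_real ((x(j := t)) i)) has_vector_derivative
        (if i = j then 1 else 0)) (at (x j))"
      by (auto intro!: derivative_eq_intros)
  qed (rule polys.const)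
next
  case (add f g)
  then obtain d e where "d \<in> polys" "e \<in> polys"
    and d: "\<And>x. ((\<lambda>t. f (x(j := t))) has_vector_derivative d x) (at (x j))"
    and e: "\<And>x. ((\<lambda>t. g (x(j := t))) has_vector_derivative e x) (at (x j))"
    by blast
  then show ?case
    by (intro bexI[of _ "\<lambda>x. d x + e x"] allI has_vector_derivative_add polys.add)
next
  case (mult f g)
  then obtain d e where de: "d \<in> polys" "e \<in> polys"
    and d: "\<And>x. ((\<lambda>t. f (x(j := t))) has_vector_derivative d x) (at (x j))"
    and e: "\<And>x. ((\<lambda>t. g (x(j := t))) has_vector_derivative e x) (at (x j))"
    by blast
  show ?case
  proof (rule bexI[of _ "\<lambda>x. f x * e x + d x * g x"])
    show "\<forall>x. ((\<lambda>t. f (x(j := t)) * g (x(j := t))) has_vector_derivative f x * e x + d x * g x) (at (x j))"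
    proof
      fix x
      show "((\<lambda>t. f (x(j := t)) * g (x(j := t))) has_vector_derivative f x * e x + d x * g x) (at (x j))"
        using has_vector_derivative_mult[OF d[of x] e[of x]] by simp
    qed
  qed (use mult de in \<open>auto intro: polys.intros\<close>)
qed

text \<open>Twisted Leibniz rule: writing \<open>s\<close> for the swap,
  \<open>f g - (s f) (s g) = (f - s f) g + (s f) (g - s g)\<close>, so a product inherits
  divisibility by \<open>x j - x k\<close> from its factors.\<close>

lemma polys_divided_difference:
  "f \<in> polys \<Longrightarrow>
    \<exists>q\<in>polys. \<forall>x. complex_of_real (x j - x k) * q x = f x - f (swapv j k x)"
proof (induction rule: polys.induct)
  case (const c)
  show ?case by (rule bexI[of _ "\<lambda>x. 0"]) (auto intro: polys.const)
next
  case (coord i)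
  show ?case
    by (rule bexI[of _ "\<lambda>x. if i = j then 1 else if i = k then -1 else 0"])
      (auto simp: swapv_def intro: polys.const)
next
  case (add f g)
  then obtain q r where "q \<in> polys" "r \<in> polys"
    and "\<And>x. complex_of_real (x j - x k) * q x = f x - f (swapv j k x)"
    and "\<And>x. complex_of_real (x j - x k) * r x = g x - g (swapv j k x)"
    by blast
  then show ?case
    by (intro bexI[of _ "\<lambda>x. q x + r x"]) (auto intro: polys.intros simp: distrib_left)
next
  case (mult f g)
  then obtain q r where qr: "q \<in> polys" "r \<in> polys"
    and q: "\<And>x. complex_of_real (x j - x k) * q x = f x - f (swapv j k x)"
    and r: "\<And>x. complex_of_real (x j - x k) * r x = g x - g (swapv j k x)"
    by blast
  have sw: "(\<lambda>x. f (swapv j k x)) \<in> polys"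
    using polys_swap[OF mult(1)] by (simp add: sw_def)
  show ?case
  proof (rule bexI[of _ "\<lambda>x. q x * g x + f (swapv j k x) * r x"], rule allI)
    fix x
    have "complex_of_real (x j - x k) * (q x * g x + f (swapv j k x) * r x)
        = (complex_of_real (x j - x k) * q x) * g x
          + f (swapv j k x) * (complex_of_real (x j - x k) * r x)"
      by (simp only: algebra_simps)
    also have "\<dots> = f x * g x - f (swapv j k x) * g (swapv j k x)"
      by (simp only: q r) (simp add: algebra_simps)
    finally show "complex_of_real (x j - x k) * (q x * g x + f (swapv j k x) * r x)
        = f x * g x - f (swapv j k x) * g (swapv j k x)" .
  qed (use mult qr sw in \<open>auto intro: polys.intros\<close>)
qed

lemma polys_continuous:
  "f \<in> polys \<Longrightarrow> continuous_on UNIV (\<lambda>t. f (x(j := t)))"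
proof (induction rule: polys.induct)
  case (coord i)
  show ?case by (cases "i = j") (auto intro!: continuous_intros)
qed (auto intro!: continuous_intros)

typedef cpoly = polys
  morphisms peval Abs_cpoly
  by (auto intro: polys.const)

setup_lifting type_definition_cpoly

instantiation cpoly :: comm_ring_1
begin

lift_definition zero_cpoly :: cpoly is "\<lambda>x. 0" by (rule polys.const)
lift_definition one_cpoly :: cpoly is "\<lambda>x. 1" by (rule polys.const)
lift_definition plus_cpoly :: "cpoly \<Rightarrow> cpoly \<Rightarrow> cpoly" is "\<lambda>f g x. f x + g x"
  by (rule polys.add)
lift_definition times_cpoly :: "cpoly \<Rightarrow> cpoly \<Rightarrow> cpoly" is "\<lambda>f g x. f x * g x"
  by (rule polys.mult)
lift_definition uminus_cpoly :: "cpoly \<Rightarrow> cpoly" is "\<lambda>f x. - f x"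
  by (rule polys_uminus)
lift_definition minus_cpoly :: "cpoly \<Rightarrow> cpoly \<Rightarrow> cpoly" is "\<lambda>f g x. f x - g x"
  by (rule polys_diff)

instance
  by standard (transfer; auto simp: algebra_simps fun_eq_iff)+

end

lift_definition cst :: "complex \<Rightarrow> cpoly" is "\<lambda>c x. c" by (rule polys.const)
lift_definition X :: "nat \<Rightarrow> cpoly" is "\<lambda>i x. complex_of_real (x i)" by (rule polys.coord)
lift_definition S :: "nat \<Rightarrow> nat \<Rightarrow> cpoly \<Rightarrow> cpoly" is sw by (rule polys_swap)

lemma peval_simps [simp]:
  "peval 0 x = 0" "peval 1 x = 1" "peval (p + q) x = peval p x + peval q x"
  "peval (p * q) x = peval p x * peval q x" "peval (- p) x = - peval p x"
  "peval (p - q) x = peval p x - peval q x"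
  "peval (cst c) x = c" "peval (X i) x = complex_of_real (x i)"
  "peval (S i j p) x = peval p (swapv i j x)"
  by (transfer; simp add: sw_def)+

lemma peval_sum [simp]: "peval (sum f A) x = (\<Sum>i\<in>A. peval (f i) x)"
  by (induction A rule: infinite_finite_induct) auto

lemma peval_prod [simp]: "peval (prod f A) x = (\<Prod>i\<in>A. peval (f i) x)"
  by (induction A rule: infinite_finite_induct) auto

lemma peval_power [simp]: "peval (p ^ n) x = peval p x ^ n"
  by (induction n) auto

lemma cpoly_eqI: "(\<And>x. peval p x = peval q x) \<Longrightarrow> p = q"
  by (metis ext peval_inject)

lemma cpoly_induct [case_names cst X add mult]:
  assumes "\<And>c. P (cst c)" "\<And>i. P (X i)"
    "\<And>p q. P p \<Longrightarrow> P q \<Longrightarrow> P (p + q)" "\<And>p q. P p \<Longrightarrow> P q \<Longrightarrow> P (p * q)"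
  shows "P p"
proof -
  have "P (Abs_cpoly f)" if "f \<in> polys" for f
    using that
  proof (induction rule: polys.induct)
    case (const c)
    then show ?case using assms(1)[of c] by (simp add: cst_def)
  next
    case (coord i)
    then show ?case using assms(2)[of i] by (simp add: X_def)
  next
    case (add f g)
    then show ?case using assms(3)[of "Abs_cpoly f" "Abs_cpoly g"]
      by (simp add: plus_cpoly_def Abs_cpoly_inverse)
  next
    case (mult f g)
    then show ?case using assms(4)[of "Abs_cpoly f" "Abs_cpoly g"]
      by (simp add: times_cpoly_def Abs_cpoly_inverse)
  qed
  then show ?thesis by (metis peval peval_inverse)
qed

lemma cst_simps: "cst 0 = 0" "cst 1 = 1" "cst (a + b) = cst a + cst b"
  "cst (a * b) = cst a * cst b" "cst (- a) = - cst a" "cst (a - b) = cst a - cst b"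
  by (rule cpoly_eqI, simp)+

text \<open>Off the hyperplane \<open>x j = x k\<close> the factor can be divided out, and
  continuity in the coordinate \<open>j\<close> extends the equality to the hyperplane. Divided
  differences are therefore unique, and identities for them may be checked after multiplication by
  \<open>X j - X k\<close>.\<close>

lemma X_diff_cancel:
  assumes "j \<noteq> k" "(X j - X k) * p = (X j - X k) * q"
  shows "p = q"
proof (rule cpoly_eqI)
  fix x :: "nat \<Rightarrow> real"
  define d where "d = (\<lambda>t. peval (p - q) (x(j := t)))"
  have "continuous_on UNIV d"
    unfolding d_def using peval by (rule polys_continuous)
  moreover have "d t = 0" if "t \<noteq> x k" for t
  proof -
    have "peval ((X j - X k) * (p - q)) (x(j := t)) = 0"
      using assms(2) by (simp add: right_diff_distrib)
    then show ?thesis using assms(1) that by (simp add: d_def)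
  qed
  ultimately have "d (x k) = 0"
  proof -
    assume cont: "continuous_on UNIV d" and z: "\<And>t. t \<noteq> x k \<Longrightarrow> d t = 0"
    have "(d \<longlongrightarrow> d (x k)) (at (x k))"
      using cont by (simp add: continuous_on_def)
    moreover have "(d \<longlongrightarrow> 0) (at (x k))"
      by (rule tendsto_eventually) (auto simp: eventually_at_filter z)
    ultimately show "d (x k) = 0"
      by (rule tendsto_unique[rotated]) simp
  qed
  then have "d (x j) = 0"
    using \<open>\<And>t. t \<noteq> x k \<Longrightarrow> d t = 0\<close> by (cases "x j = x k") auto
  then show "peval p x = peval q x" by (simp add: d_def)
qed

section \<open>Partial derivatives and divided differences\<close>

definition pder :: "nat \<Rightarrow> cpoly \<Rightarrow> cpoly" where
  "pder j p = (SOME d. \<forall>x. ((\<lambda>t. peval p (x(j := t))) has_vector_derivative peval d x) (at (x j)))"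

text \<open>For \<open>j = k\<close> the defining equation reads \<open>0 = 0\<close> and the value
  is arbitrary, hence the hypothesis \<open>j \<noteq> k\<close> in the rules for
  \<open>dd\<close>.\<close>

definition dd :: "nat \<Rightarrow> nat \<Rightarrow> cpoly \<Rightarrow> cpoly" where
  "dd j k p = (SOME q. (X j - X k) * q = p - S j k p)"

lemma has_vector_derivative_pder:
  "((\<lambda>t. peval p (x(j := t))) has_vector_derivative peval (pder j p) x) (at (x j))"
proof -
  have "\<exists>d. \<forall>x. ((\<lambda>t. peval p (x(j := t))) has_vector_derivative peval d x) (at (x j))"
    using polys_vector_derivative[OF peval, of p j] by (metis Abs_cpoly_inverse)
  from someI_ex[OF this] show ?thesis unfolding pder_def by blast
qed

lemma pder_eqI:
  assumes "\<And>x. ((\<lambda>t. peval p (x(j := t))) has_vector_derivative peval d x) (at (x j))"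
  shows "pder j p = d"
  by (rule cpoly_eqI) (metis assms has_vector_derivative_pder vector_derivative_unique_at)

lemma dd: "(X j - X k) * dd j k p = p - S j k p"
proof -
  have "\<exists>q. (X j - X k) * q = p - S j k p"
    using polys_divided_difference[OF peval, where x1 = p and j = j and k = k]
    by (metis (mono_tags, lifting) Abs_cpoly_inverse cpoly_eqI of_real_diff peval_simps(4,6,8,9))
  from someI_ex[OF this] show ?thesis unfolding dd_def .
qed

lemma dd_eqI: "j \<noteq> k \<Longrightarrow> (X j - X k) * q = p - S j k p \<Longrightarrow> dd j k p = q"
  by (rule X_diff_cancel[of j k]) (simp_all add: dd)

section \<open>Dunkl operators\<close>

lemma swapv_eq_comp: "swapv i j x = x \<circ> transpose i j"
  by (auto simp: swapv_def transpose_def fun_eq_iff)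

lemma S_ring_hom [simp]:
  "S i j 0 = 0" "S i j 1 = 1" "S i j (cst c) = cst c" "S i j (p + q) = S i j p + S i j q"
  "S i j (p - q) = S i j p - S i j q" "S i j (- p) = - S i j p" "S i j (p * q) = S i j p * S i j q"
  by (rule cpoly_eqI, simp)+

lemma S_sum: "S i j (sum f A) = (\<Sum>x\<in>A. S i j (f x))"
  by (rule cpoly_eqI) simp

lemma S_prod: "S i j (prod f A) = (\<Prod>x\<in>A. S i j (f x))"
  by (rule cpoly_eqI) simp

lemma S_power: "S i j (p ^ n) = S i j p ^ n"
  by (rule cpoly_eqI) simp

lemma S_X [simp]: "S i j (X k) = X (transpose i j k)"
  by (rule cpoly_eqI) (simp add: swapv_eq_comp)

lemma S_S [simp]: "S i j (S i j p) = p"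
  by (rule cpoly_eqI) (simp add: swapv_eq_comp comp_assoc)

lemma S_refl [simp]: "S i i p = p"
  by (rule cpoly_eqI) (simp add: swapv_eq_comp)

lemma S_commute: "S i j p = S j i p"
  by (rule cpoly_eqI) (simp add: swapv_eq_comp transpose_commute)

lemma S_conj: "S i j (S k l p) = S (transpose i j k) (transpose i j l) (S i j p)"
proof (rule cpoly_eqI)
  fix x :: "nat \<Rightarrow> real"
  have "transpose i j \<circ> transpose k l
      = transpose (transpose i j k) (transpose i j l) \<circ> transpose i j"
    by (auto simp: fun_eq_iff transpose_def)
  then show "peval (S i j (S k l p)) x
      = peval (S (transpose i j k) (transpose i j l) (S i j p)) x"
    by (simp add: swapv_eq_comp comp_assoc)
qed

lemma pder_cst [simp]: "pder j (cst c) = 0"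
  by (rule pder_eqI) simp

lemma pder_X: "pder j (X i) = (if i = j then 1 else 0)"
  by (rule pder_eqI) (auto intro!: derivative_eq_intros)

lemma pder_add [simp]: "pder j (p + q) = pder j p + pder j q"
  by (rule pder_eqI) (auto intro!: has_vector_derivative_add has_vector_derivative_pder simp del: fun_upd_apply)

lemma pder_mult: "pder j (p * q) = p * pder j q + pder j p * q"
proof (rule pder_eqI)
  fix x
  show "((\<lambda>t. peval (p * q) (x(j := t))) has_vector_derivative
      peval (p * pder j q + pder j p * q) x) (at (x j))"
    using has_vector_derivative_mult[OF has_vector_derivative_pder[where p = p and j = j and x = x]
        has_vector_derivative_pder[where p = q and j = j and x = x]] by simp
qed

lemma pder_cst_mult [simp]: "pder j (cst c * p) = cst c * pder j p"
  by (simp add: pder_mult)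

lemma pder_uminus [simp]: "pder j (- p) = - pder j p"
  using pder_cst_mult[of j "-1" p] by (simp add: cst_simps)

lemma pder_diff [simp]: "pder j (p - q) = pder j p - pder j q"
  using pder_add[of j p "- q"] by simp

lemma pder_1 [simp]: "pder j 1 = 0"
  using pder_cst[of j 1] by (simp add: cst_simps)

lemma pder_S: "S a b (pder c p) = pder (transpose a b c) (S a b p)"
proof (induction p rule: cpoly_induct)
  case (X i)
  show ?case by (auto simp: pder_X dest: injD[OF inj_transpose])
qed (simp_all add: pder_mult)

lemma dd_add [simp]: "j \<noteq> k \<Longrightarrow> dd j k (p + q) = dd j k p + dd j k q"
  by (rule dd_eqI) (simp_all add: distrib_left dd)

lemma dd_mult:
  assumes "j \<noteq> k" shows "dd j k (p * q) = p * dd j k q + dd j k p * S j k q"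
proof (rule dd_eqI[OF assms])
  have "(X j - X k) * (p * dd j k q + dd j k p * S j k q)
      = p * ((X j - X k) * dd j k q) + ((X j - X k) * dd j k p) * S j k q"
    by (simp only: algebra_simps)
  also have "\<dots> = p * q - S j k (p * q)"
    by (simp only: dd) (simp add: algebra_simps)
  finally show "(X j - X k) * (p * dd j k q + dd j k p * S j k q) = p * q - S j k (p * q)" .
qed

lemma dd_cst [simp]: "j \<noteq> k \<Longrightarrow> dd j k (cst c) = 0"
  by (rule dd_eqI) simp_all

lemma dd_cst_mult [simp]: "j \<noteq> k \<Longrightarrow> dd j k (cst c * p) = cst c * dd j k p"
  by (simp add: dd_mult)

lemma dd_X: "j \<noteq> k \<Longrightarrow> dd j k (X i) = (if i = j then 1 else if i = k then - 1 else 0)"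
  by (rule dd_eqI) auto

lemma dd_S:
  assumes "j \<noteq> k"
  shows "S a b (dd j k p) = dd (transpose a b j) (transpose a b k) (S a b p)"
proof (rule dd_eqI[symmetric])
  show "transpose a b j \<noteq> transpose a b k"
    using assms by (metis transpose_involutory)
  have "S a b ((X j - X k) * dd j k p) = S a b (p - S j k p)"
    by (simp only: dd)
  then show "(X (transpose a b j) - X (transpose a b k)) * S a b (dd j k p)
      = S a b p - S (transpose a b j) (transpose a b k) (S a b p)"
    by (simp add: S_conj[of a b j k])
qed

definition Du :: "nat \<Rightarrow> complex \<Rightarrow> nat \<Rightarrow> cpoly \<Rightarrow> cpoly" where
  "Du N b j p = pder j p + cst b * (\<Sum>k\<in>{..<N}-{j}. dd j k p)"

lemma Du_add [simp]: "Du N b j (p + q) = Du N b j p + Du N b j q"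
  by (simp add: Du_def sum.distrib distrib_left)

lemma Du_cst_mult [simp]: "Du N b j (cst c * p) = cst c * Du N b j p"
  by (simp add: Du_def distrib_left mult.left_commute flip: sum_distrib_left)

lemma Du_uminus [simp]: "Du N b j (- p) = - Du N b j p"
  using Du_cst_mult[of N b j "-1" p] by (simp add: cst_simps)

lemma Du_diff [simp]: "Du N b j (p - q) = Du N b j p - Du N b j q"
  using Du_add[of N b j p "- q"] by simp

lemma Du_cst [simp]: "Du N b j (cst c) = 0"
  by (simp add: Du_def)

lemma Du_0 [simp]: "Du N b j 0 = 0"
  using Du_cst[of N b j 0] by (simp add: cst_simps)

lemma Du_sum: "Du N b j (sum f A) = (\<Sum>x\<in>A. Du N b j (f x))"
  by (induction A rule: infinite_finite_induct) auto

lemma bij_betw_transpose_Diff: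
  assumes "a \<in> A" "b \<in> A"
  shows "bij_betw (transpose a b) (A - {j}) (A - {transpose a b j})"
proof -
  have "transpose a b ` A = A"
    using assms by simp
  then show ?thesis
    by (simp add: bij_betw_def image_set_diff inj_on_subset[OF inj_transpose])
qed

lemma S_Du:
  assumes "a < N" "b < N"
  shows "S a b (Du N \<beta> j p) = Du N \<beta> (transpose a b j) (S a b p)"
proof -
  have "(\<Sum>k\<in>{..<N}-{j}. S a b (dd j k p))
      = (\<Sum>k\<in>{..<N}-{j}. dd (transpose a b j) (transpose a b k) (S a b p))"
    by (intro sum.cong) (auto simp: dd_S)
  also have "\<dots> = (\<Sum>k\<in>{..<N}-{transpose a b j}. dd (transpose a b j) k (S a b p))"
    using bij_betw_transpose_Diff[of a "{..<N}" b j] assms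
    by (intro sum.reindex_bij_betw) auto
  finally show ?thesis by (simp add: Du_def S_sum pder_S)
qed

text \<open>Together with \<open>Du_X\<close> this gives the commutation relations of the rational
  Cherednik algebra of type A: moving \<open>D_j\<close> past \<open>x_j\<close> creates all
  \<open>s_jk\<close>, moving it past another \<open>x_i\<close> only \<open>s_ij\<close>.\<close>

lemma Du_X_self:
  "Du N b j (X j * p) = X j * Du N b j p + p + cst b * (\<Sum>k\<in>{..<N}-{j}. S j k p)"
proof -
  have "(\<Sum>k\<in>{..<N}-{j}. dd j k (X j * p)) = (\<Sum>k\<in>{..<N}-{j}. X j * dd j k p + S j k p)"
    by (intro sum.cong) (auto simp: dd_mult dd_X)
  then show ?thesis
    by (simp add: Du_def pder_mult pder_X sum.distrib sum_distrib_left[symmetric] algebra_simps)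
qed

lemma Du_X:
  assumes "i \<noteq> j" "i < N"
  shows "Du N b j (X i * p) = X i * Du N b j p - cst b * S i j p"
proof -
  have "(\<Sum>k\<in>{..<N}-{j}. dd j k (X i * p))
      = (\<Sum>k\<in>{..<N}-{j}. X i * dd j k p - (if k = i then S j k p else 0))"
    using assms by (intro sum.cong) (auto simp: dd_mult dd_X)
  also have "\<dots> = X i * (\<Sum>k\<in>{..<N}-{j}. dd j k p) - S i j p"
    using assms by (simp add: sum_subtractf sum_distrib_left S_commute[of i j])
  finally show ?thesis
    using assms by (simp add: Du_def pder_mult pder_X distrib_left right_diff_distrib mult.left_commute)
qed

lemma Du_X_outside:
  assumes "i \<noteq> j" "i \<ge> N"
  shows "Du N b j (X i * p) = X i * Du N b j p"
proof -
  have "(\<Sum>k\<in>{..<N}-{j}. dd j k (X i * p)) = (\<Sum>k\<in>{..<N}-{j}. X i * dd j k p)"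
    using assms by (intro sum.cong) (auto simp: dd_mult dd_X)
  then show ?thesis
    using assms by (simp add: Du_def pder_mult pder_X sum_distrib_left algebra_simps)
qed

text \<open>The delicate case of \<open>Du_commutes\<close>, since \<open>X i\<close> creates a
  whole sum of transpositions when it passes \<open>D_i\<close>.\<close>

lemma Du_commutator_X_self:
  assumes "i < N" "j < N" "i \<noteq> j"
  shows "Du N b i (Du N b j (X i * q)) - Du N b j (Du N b i (X i * q))
    = X i * (Du N b i (Du N b j q) - Du N b j (Du N b i q))"
proof -
  \<comment> \<open>\<open>s_ik\<close> commutes with \<open>D_j\<close> unless
    \<open>k = j\<close>. The surviving term cancels against the terms with \<open>b s_ij\<close>
    that arise when \<open>X i\<close> passes \<open>D_j\<close>.\<close>
  have "(\<Sum>k\<in>{..<N}-{i}. S i k (Du N b j q)) - (\<Sum>k\<in>{..<N}-{i}. Du N b j (S i k q))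
      = (\<Sum>k\<in>{..<N}-{i}. if k = j then Du N b i (S i j q) - Du N b j (S i j q) else 0)"
    unfolding sum_subtractf[symmetric] using assms
    by (intro sum.cong) (auto simp: S_Du transpose_def)
  also have "\<dots> = Du N b i (S i j q) - Du N b j (S i j q)"
    using assms by simp
  finally have "(\<Sum>k\<in>{..<N}-{i}. S i k (Du N b j q))
      = (\<Sum>k\<in>{..<N}-{i}. Du N b j (S i k q)) + Du N b i (S i j q) - Du N b j (S i j q)"
    by (simp add: algebra_simps)
  then show ?thesis
    using assms by (simp add: Du_X Du_X_self Du_sum S_Du) (simp add: algebra_simps)
qed

text \<open>The commutator of two Dunkl operators commutes with all multiplications and kills constants.\<close>

lemma Du_commutes:
  assumes "i < N" "j < N"
  shows "Du N b i (Du N b j p) = Du N b j (Du N b i p)"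
proof (cases "i = j")
  case False
  define C where "C q = Du N b i (Du N b j q) - Du N b j (Du N b i q)" for q
  have C_add: "C (q + r) = C q + C r" for q r
    by (simp add: C_def)
  have "\<forall>q. C (p * q) = p * C q"
  proof (induction p rule: cpoly_induct)
    case (X k)
    consider "k = i" | "k = j" | "k \<noteq> i" "k \<noteq> j" "k < N" | "k \<noteq> i" "k \<noteq> j" "k \<ge> N"
      by linarith
    then show ?case
    proof cases
      case 1
      then show ?thesis using Du_commutator_X_self assms False by (simp add: C_def)
    next
      case 2
      then have "Du N b j (Du N b i (X k * q)) - Du N b i (Du N b j (X k * q))
          = X k * (Du N b j (Du N b i q) - Du N b i (Du N b j q))" for q
        using Du_commutator_X_self assms False by simp
      then show ?thesis by (metis C_def minus_diff_eq mult_minus_right)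
    next
      case 3
      then show ?thesis
        using assms False by (simp add: C_def Du_X S_Du transpose_def right_diff_distrib)
    next
      case 4
      then show ?thesis by (simp add: C_def Du_X_outside right_diff_distrib)
    qed
  next
    case (cst c)
    show ?case by (simp add: C_def right_diff_distrib)
  next
    case (add p q)
    then show ?case by (simp add: C_add distrib_right)
  next
    case (mult p q)
    then show ?case by (simp add: mult.assoc)
  qed
  then have "C (p * cst 1) = 0"
    by (simp add: C_def)
  then show ?thesis by (simp add: C_def cst_simps)
qed simp

text \<open>The product of the creation and the annihilation operator, that is, \<open>hA\<close>
  without its transpositions. The partial sum over \<open>k < j\<close> would destroy the symmetry
  \<open>S_H\<close>.\<close>

definition H :: "nat \<Rightarrow> complex \<Rightarrow> nat \<Rightarrow> cpoly \<Rightarrow> cpoly" where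
  "H N b j p = X j * Du N b j p - cst (1/2) * Du N b j (Du N b j p)"

lemma H_linear [simp]:
  "H N b j (p + q) = H N b j p + H N b j q" "H N b j (p - q) = H N b j p - H N b j q"
  "H N b j (cst c * p) = cst c * H N b j p" "H N b j 0 = 0" "H N b j (- p) = - H N b j p"
  by (simp_all add: H_def distrib_left right_diff_distrib mult.left_commute)

lemma S_H:
  assumes "i < N" "j < N"
  shows "S i j (H N b k p) = H N b (transpose i j k) (S i j p)"
  using assms by (simp add: H_def S_Du)

text \<open>The Dunkl operators commute with each other, and \<open>D_i\<close> commutes with
  \<open>x_j\<close> up to a multiple of \<open>s_ij\<close>. The right side has one
  \<open>H\<close> where the left has two, which is why letters commute up to shorter words.\<close>

lemma H_commutator:
  assumes "i < N" "j < N"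
  shows "H N b i (H N b j p) - H N b j (H N b i p)
    = cst b * (H N b j (S i j p) - H N b i (S i j p))"
proof (cases "i = j")
  case False
  have comm: "Du N b j (Du N b i q) = Du N b i (Du N b j q)" for q
    using assms by (rule Du_commutes[symmetric])
  note rules = Du_X[OF False assms(1)] Du_X[OF False[symmetric] assms(2)] S_Du[OF assms] comm
    S_commute[of j i]
  show ?thesis
    by (simp add: H_def rules right_diff_distrib)
qed simp

section \<open>Words in the operators \<open>H\<close>\<close>

text \<open>A filtration by word length. Transpositions are not letters: on an antisymmetric
  \<open>h\<close> they only rename the letters and change the sign (\<open>S_word\<close>), so each
  level is stable under them.\<close>

inductive_set wspan :: "nat \<Rightarrow> complex \<Rightarrow> cpoly \<Rightarrow> nat \<Rightarrow> cpoly set"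
  for N b h n where
  word: "set w \<subseteq> {..<N} \<Longrightarrow> length w \<le> n \<Longrightarrow> foldr (H N b) w h \<in> wspan N b h n"
| add: "u \<in> wspan N b h n \<Longrightarrow> v \<in> wspan N b h n \<Longrightarrow> u + v \<in> wspan N b h n"
| scale: "u \<in> wspan N b h n \<Longrightarrow> cst c * u \<in> wspan N b h n"

lemma wspan_base: "h \<in> wspan N b h n"
  using wspan.word[of "[]"] by simp

lemma wspan_0: "0 \<in> wspan N b h n"
  using wspan.scale[OF wspan_base, of 0] by (simp add: cst_simps)

lemma wspan_uminus: "u \<in> wspan N b h n \<Longrightarrow> - u \<in> wspan N b h n"
  using wspan.scale[of u N b h n "- 1"] by (simp add: cst_simps)

lemma wspan_diff: "u \<in> wspan N b h n \<Longrightarrow> v \<in> wspan N b h n \<Longrightarrow> u - v \<in> wspan N b h n"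
  using wspan.add[OF _ wspan_uminus, of u N b h n v] by simp

lemma wspan_sum: "(\<And>i. i \<in> A \<Longrightarrow> f i \<in> wspan N b h n) \<Longrightarrow> sum f A \<in> wspan N b h n"
  by (induction A rule: infinite_finite_induct) (auto intro: wspan.add wspan_0)

lemma wspan_mono: "u \<in> wspan N b h m \<Longrightarrow> m \<le> n \<Longrightarrow> u \<in> wspan N b h n"
  by (induction rule: wspan.induct) (auto intro: wspan.intros)

lemma wspan_H:
  assumes "u \<in> wspan N b h n" "i < N"
  shows "H N b i u \<in> wspan N b h (Suc n)"
  using assms(1)
proof (induction rule: wspan.induct)
  case (word w)
  then show ?case using wspan.word[of "i # w" N "Suc n" b h] assms(2) by simp
qed (auto intro: wspan.intros)

text \<open>The span of the words of length less than \<open>m\<close>.\<close>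

definition lower :: "nat \<Rightarrow> complex \<Rightarrow> cpoly \<Rightarrow> nat \<Rightarrow> cpoly set" where
  "lower N b h m = (if m = 0 then {0} else wspan N b h (m - 1))"

lemma lower_0: "0 \<in> lower N b h m"
  by (simp add: lower_def wspan_0)

lemma lower_add: "u \<in> lower N b h m \<Longrightarrow> v \<in> lower N b h m \<Longrightarrow> u + v \<in> lower N b h m"
  by (auto simp: lower_def wspan.add split: if_splits)

lemma lower_diff: "u \<in> lower N b h m \<Longrightarrow> v \<in> lower N b h m \<Longrightarrow> u - v \<in> lower N b h m"
  by (auto simp: lower_def wspan_diff split: if_splits)

lemma lower_trans: "u - v \<in> lower N b h m \<Longrightarrow> v - w \<in> lower N b h m \<Longrightarrow> u - w \<in> lower N b h m"
  using lower_add[of "u - v" N b h m "v - w"] by simp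

lemma wspan_trans: "u - v \<in> wspan N b h n \<Longrightarrow> v - w \<in> wspan N b h n \<Longrightarrow> u - w \<in> wspan N b h n"
  using wspan.add[of "u - v" N b h n "v - w"] by simp

lemma lower_Suc: "lower N b h (Suc m) = wspan N b h m"
  by (simp add: lower_def)

lemma wspan_H_diff:
  "u - v \<in> wspan N b h n \<Longrightarrow> i < N \<Longrightarrow> H N b i u - H N b i v \<in> wspan N b h (Suc n)"
  using wspan_H[of "u - v" N b h n i] by simp

lemma lower_H: "u \<in> lower N b h m \<Longrightarrow> i < N \<Longrightarrow> H N b i u \<in> lower N b h (Suc m)"
  by (cases m) (auto simp: lower_def wspan_0 intro: wspan_H)

lemma lower_H_diff:
  "u - v \<in> lower N b h m \<Longrightarrow> i < N \<Longrightarrow> H N b i u - H N b i v \<in> lower N b h (Suc m)"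
  using lower_H[of "u - v" N b h m i] by simp

locale antisymmetric =
  fixes N :: nat and b :: complex and h :: cpoly
  assumes S_h: "i < N \<Longrightarrow> j < N \<Longrightarrow> i \<noteq> j \<Longrightarrow> S i j h = - h"
begin

lemma S_word:
  assumes "i < N" "j < N" "i \<noteq> j"
  shows "S i j (foldr (H N b) w h) = - foldr (H N b) (map (transpose i j) w) h"
  using assms by (induction w) (auto simp: S_h S_H)

lemma wspan_S:
  assumes "u \<in> wspan N b h n" "i < N" "j < N"
  shows "S i j u \<in> wspan N b h n"
  using assms(1)
proof (induction rule: wspan.induct)
  case (word w)
  show ?case
  proof (cases "i = j")
    case False
    have "set (map (transpose i j) w) \<subseteq> {..<N}"
      using word assms by (auto simp: transpose_def)
    then have "foldr (H N b) (map (transpose i j) w) h \<in> wspan N b h n"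
      using word by (intro wspan.word) auto
    then show ?thesis
      using wspan_uminus S_word[OF assms(2,3) False] by metis
  qed (use word in \<open>auto intro: wspan.word\<close>)
qed (auto intro: wspan.intros)

text \<open>Two letters would raise the length bound by two; by \<open>H_commutator\<close> their
  commutator raises it only by one.\<close>

lemma H_commute_mod:
  assumes "u \<in> wspan N b h n" "i < N" "j < N"
  shows "H N b i (H N b j u) - H N b j (H N b i u) \<in> wspan N b h (Suc n)"
  using assms by (auto simp: H_commutator intro!: wspan.scale wspan_diff wspan_H wspan_S)

lemma word_move_mod:
  assumes "set (x # u @ v) \<subseteq> {..<N}"
  shows "foldr (H N b) (u @ x # v) h - foldr (H N b) (x # u @ v) h
    \<in> lower N b h (Suc (length (u @ v)))"
  using assms
proof (induction u)
  case (Cons y u)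
  let ?r = "foldr (H N b) (u @ v) h"
  have "foldr (H N b) (u @ x # v) h - H N b x ?r \<in> wspan N b h (length (u @ v))"
    using Cons by (simp add: lower_Suc)
  then have "H N b y (foldr (H N b) (u @ x # v) h) - H N b y (H N b x ?r)
      \<in> wspan N b h (Suc (length (u @ v)))"
    using Cons.prems by (intro wspan_H_diff) auto
  moreover have "?r \<in> wspan N b h (length (u @ v))"
    using Cons.prems by (intro wspan.word) auto
  then have "H N b y (H N b x ?r) - H N b x (H N b y ?r) \<in> wspan N b h (Suc (length (u @ v)))"
    using Cons.prems by (intro H_commute_mod) auto
  ultimately have "H N b y (foldr (H N b) (u @ x # v) h) - H N b x (H N b y ?r)
      \<in> wspan N b h (Suc (length (u @ v)))"
    by (rule wspan_trans)
  then show ?case by (simp add: lower_Suc)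
qed (simp add: lower_0)

text \<open>Modulo shorter words only the multiset of letters matters: the first letter of
  \<open>w\<close> is brought to the front of \<open>v\<close>, and the induction hypothesis
  compares the remainders.\<close>

lemma word_mset_mod:
  assumes "mset v = mset w" "set w \<subseteq> {..<N}"
  shows "foldr (H N b) v h - foldr (H N b) w h \<in> lower N b h (length w)"
  using assms
proof (induction w arbitrary: v)
  case Nil
  then show ?case by (simp add: lower_0)
next
  case (Cons x w)
  then have "x \<in> set v" by (metis list.set_intros(1) mset_eq_setD)
  then obtain v1 v2 where v: "v = v1 @ x # v2" by (meson split_list)
  have m: "mset (v1 @ v2) = mset w" using Cons.prems(1) v by simp
  then have "length (v1 @ v2) = length w" "set (v1 @ v2) = set w"
    by (metis size_mset, metis mset_eq_setD)
  then have 1: "foldr (H N b) v h - H N b x (foldr (H N b) (v1 @ v2) h) \<in> lower N b h (length (x # w))"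
    using word_move_mod[of x v1 v2] Cons.prems by (simp add: v)
  have "foldr (H N b) (v1 @ v2) h - foldr (H N b) w h \<in> lower N b h (length w)"
    using Cons.IH[OF m] Cons.prems by simp
  then have "H N b x (foldr (H N b) (v1 @ v2) h) - H N b x (foldr (H N b) w h)
      \<in> lower N b h (length (x # w))"
    using Cons.prems lower_H_diff by simp
  from lower_trans[OF 1 this] show ?case by simp
qed

end

section \<open>Multiplicities of letters in short words\<close>

lemma sum_distinct_ge:
  assumes "finite A" shows "(\<Sum>i<card A. i) \<le> \<Sum> (A :: nat set)"
  using assms
proof (induction "card A" arbitrary: A)
  case (Suc n)
  then have ne: "A \<noteq> {}" by auto
  let ?m = "Max A"
  have "card (A - {?m}) = n" using Suc ne by simp
  then have "(\<Sum>i<n. i) \<le> \<Sum> (A - {?m})" using Suc by (metis finite_Diff)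
  moreover have "A \<subseteq> {..?m}" using Suc by auto
  then have "n \<le> ?m"
    using card_mono[of "{..?m}" A] Suc(2) by simp
  moreover have "\<Sum> A = ?m + \<Sum> (A - {?m})"
    using Suc ne by (intro sum.remove) auto
  ultimately show ?case using Suc(2) by (simp flip: Suc(2))
qed simp

text \<open>If the \<open>N\<close> multiplicities, zero included, were pairwise distinct, their
  sum, which is the length of \<open>w\<close>, would be at least
  \<open>0 + 1 + ... + (N - 1)\<close>.\<close>

lemma short_word_repeats_count:
  assumes "set w \<subseteq> {..<N}" "length w < (\<Sum>i<N. i)"
  shows "\<exists>a<N. \<exists>c<N. a \<noteq> c \<and> count (mset w) a = count (mset w) c"
proof (rule ccontr)
  assume "\<not> ?thesis"
  then have inj: "inj_on (count (mset w)) {..<N}" by (auto simp: inj_on_def)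
  have "(\<Sum>i<N. i) \<le> \<Sum> (count (mset w) ` {..<N})"
    using sum_distinct_ge[of "count (mset w) ` {..<N}"] inj by (simp add: card_image)
  also have "\<dots> = (\<Sum>i<N. count (mset w) i)"
    using inj by (simp add: sum.reindex)
  also have "\<dots> = (\<Sum>i\<in>set_mset (mset w). count (mset w) i)"
    using assms(1) by (intro sum.mono_neutral_right) (auto simp: count_eq_zero_iff)
  also have "\<dots> = length w"
    by (metis size_multiset_overloaded_eq size_mset)
  finally show False using assms(2) by simp
qed

lemma mset_map_transpose_eq:
  assumes "count (mset w) a = count (mset w) c"
  shows "mset (map (transpose a c) w) = mset w"
proof (rule multiset_eqI)
  fix x
  have "transpose a c -` {x} = {transpose a c x}"
    by (auto simp: transpose_def split: if_splits)
  then have "count (mset (map (transpose a c) w)) x = count (mset w) (transpose a c x)"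
    by (cases "transpose a c x \<in># mset w") (simp_all add: count_image_mset not_in_iff del: in_multiset_in_set set_mset_mset)
  then show "count (mset (map (transpose a c) w)) x = count (mset w) x"
    using assms by (auto simp: transpose_def)
qed

context antisymmetric
begin

text \<open>Used with \<open>L\<close> the pairing against a symmetric polynomial. The bound on
  \<open>m\<close> keeps every word in \<open>lower N b h m\<close> short enough for two letters to
  have equal multiplicity.\<close>

lemma symmetric_functional_vanishes:
  fixes L :: "cpoly \<Rightarrow> complex"
  assumes L_add: "\<And>u v. L (u + v) = L u + L v"
    and L_scale: "\<And>c u. L (cst c * u) = c * L u"
    and L_S: "\<And>i j u. i < N \<Longrightarrow> j < N \<Longrightarrow> L (S i j u) = L u"
    and u: "u \<in> lower N b h m" and m: "m \<le> (\<Sum>i<N. i)"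
  shows "L u = 0"
proof -
  have L_uminus: "L (- v) = - L v" for v
    using L_scale[of "-1" v] by (simp add: cst_simps)
  have L_diff: "L (v - w) = L v - L w" for v w
    using L_add[of v "- w"] L_uminus by simp
  have L_0: "L 0 = 0" using L_scale[of 0 0] by simp
  \<comment> \<open>Stated for an arbitrary length \<open>n\<close> because it serves twice: inside
    the induction with \<open>n = length w\<close>, and at the end with
    \<open>n = m\<close>.\<close>
  have span: "L v = 0"
    if v: "v \<in> lower N b h n"
      and w: "\<And>w. set w \<subseteq> {..<N} \<Longrightarrow> length w < n \<Longrightarrow> L (foldr (H N b) w h) = 0" for n v
  proof (cases n)
    case 0
    then show ?thesis using v L_0 by (simp add: lower_def)
  next
    case (Suc k)
    then have "v \<in> wspan N b h k" using v by (simp add: lower_Suc)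
    then show ?thesis
    proof (induction rule: wspan.induct)
      case (word u)
      then show ?case using w Suc by simp
    qed (simp_all add: L_add L_scale)
  qed
  have word: "L (foldr (H N b) w h) = 0"
    if "set w \<subseteq> {..<N}" "length w < (\<Sum>i<N. i)" for w
    using that
  proof (induction "length w" arbitrary: w rule: less_induct)
    case less
    obtain a c where ac: "a < N" "c < N" "a \<noteq> c" "count (mset w) a = count (mset w) c"
      using short_word_repeats_count[OF less.prems] by blast
    \<comment> \<open>\<open>?w\<close> rearranges \<open>w\<close>, so the two words differ by
      shorter ones, on which \<open>L\<close> vanishes by induction. But \<open>S a c\<close> turns
      the word of \<open>w\<close> into minus that of \<open>?w\<close>, so the value of
      \<open>L\<close> equals its own negative.\<close>
    let ?w = "map (transpose a c) w"
    have "foldr (H N b) ?w h - foldr (H N b) w h \<in> lower N b h (length w)"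
      by (rule word_mset_mod[OF mset_map_transpose_eq[OF ac(4)] less.prems(1)])
    then have "L (foldr (H N b) ?w h - foldr (H N b) w h) = 0"
      by (rule span) (use less in simp)
    moreover have "L (foldr (H N b) w h) = - L (foldr (H N b) ?w h)"
      using L_S[OF ac(1,2), of "foldr (H N b) w h"] ac by (simp add: S_word L_uminus)
    ultimately show ?case by (simp add: L_diff)
  qed
  show ?thesis
    by (rule span[OF u], rule word) (use m in auto)
qed

end

section \<open>The factors of Y and their leading parts\<close>

definition hC :: "nat \<Rightarrow> complex \<Rightarrow> nat \<Rightarrow> cpoly \<Rightarrow> cpoly" where
  "hC N b j p = H N b j p + cst b * (\<Sum>k<j. S j k p)"

definition yC :: "nat \<Rightarrow> complex \<Rightarrow> complex \<Rightarrow> nat \<times> nat \<Rightarrow> cpoly \<Rightarrow> cpoly" where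
  "yC N b c = (\<lambda>(i, j) p. cst c * p - hC N b i p + hC N b j p)"

text \<open>The leading part of \<open>yC\<close> for the length filtration: the constant
  \<open>c\<close> and the transpositions do not raise the length. It is the same for every
  \<open>c\<close>.\<close>

definition zC :: "nat \<Rightarrow> complex \<Rightarrow> nat \<times> nat \<Rightarrow> cpoly \<Rightarrow> cpoly" where
  "zC N b = (\<lambda>(i, j) p. H N b j p - H N b i p)"

lemma zC_diff: "zC N b q (u - v) = zC N b q u - zC N b q v"
  by (auto simp: zC_def split: prod.splits)

context antisymmetric
begin

lemma zC_wspan: "u \<in> wspan N b h n \<Longrightarrow> q \<in> {..<N} \<times> {..<N} \<Longrightarrow> zC N b q u \<in> wspan N b h (Suc n)"
  by (auto simp: zC_def intro!: wspan_diff wspan_H)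

lemma zC_lower: "u \<in> lower N b h n \<Longrightarrow> q \<in> {..<N} \<times> {..<N} \<Longrightarrow> zC N b q u \<in> lower N b h (Suc n)"
  by (auto simp: zC_def intro!: lower_diff lower_H)

lemma zC_prod_wspan:
  "set ps \<subseteq> {..<N} \<times> {..<N} \<Longrightarrow> foldr (zC N b) ps h \<in> wspan N b h (length ps)"
  by (induction ps) (auto simp: wspan_base simp del: mem_Times_iff intro!: zC_wspan)

lemma yC_minus_zC_wspan:
  assumes "u \<in> wspan N b h n" "q \<in> {..<N} \<times> {..<N}"
  shows "yC N b c q u - zC N b q u \<in> wspan N b h n"
proof -
  obtain i j where q: "q = (i, j)" by force
  have "yC N b c q u - zC N b q u
      = cst c * u - cst b * (\<Sum>k<i. S i k u) + cst b * (\<Sum>k<j. S j k u)"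
    by (simp add: q yC_def zC_def hC_def)
  also have "\<dots> \<in> wspan N b h n"
    using assms by (auto simp: q intro!: wspan.add wspan_diff wspan.scale wspan_sum wspan_S)
  finally show ?thesis .
qed

text \<open>The factors are replaced one at a time. Replacing the head leaves an error of length at
  most that of the tail, and the error of the tail grows by one letter under
  \<open>zC\<close>.\<close>

lemma yC_prod_mod:
  assumes "set ps \<subseteq> {..<N} \<times> {..<N}"
  shows "foldr (yC N b c) ps h - foldr (zC N b) ps h \<in> lower N b h (length ps)"
  using assms
proof (induction ps)
  case (Cons q ps)
  let ?y = "foldr (yC N b c) ps h" and ?z = "foldr (zC N b) ps h"
  have q: "q \<in> {..<N} \<times> {..<N}" using Cons.prems by simp
  have IH: "?y - ?z \<in> lower N b h (length ps)" using Cons by simp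
  then have "?y - ?z \<in> wspan N b h (length ps)"
    by (auto simp: lower_def wspan_0 split: if_splits intro: wspan_mono)
  then have "?y \<in> wspan N b h (length ps)"
    using wspan.add[of "?y - ?z" N b h "length ps" ?z] zC_prod_wspan[of ps] Cons.prems by simp
  then have 1: "yC N b c q ?y - zC N b q ?y \<in> lower N b h (Suc (length ps))"
    using q by (simp add: lower_Suc yC_minus_zC_wspan)
  have "zC N b q ?y - zC N b q ?z \<in> lower N b h (Suc (length ps))"
    using zC_lower[OF IH q] by (simp add: zC_diff)
  from lower_trans[OF 1 this] show ?case by simp
qed (simp add: lower_0)

lemma zC_commute_mod:
  assumes "u \<in> wspan N b h n" "q \<in> {..<N} \<times> {..<N}" "r \<in> {..<N} \<times> {..<N}"
  shows "zC N b q (zC N b r u) - zC N b r (zC N b q u) \<in> wspan N b h (Suc n)"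
proof -
  obtain i j k l where qr: "q = (i, j)" "r = (k, l)" by (metis surj_pair)
  let ?c = "\<lambda>i j. H N b i (H N b j u) - H N b j (H N b i u)"
  have "zC N b q (zC N b r u) - zC N b r (zC N b q u) = ?c j l - ?c j k - ?c i l + ?c i k"
    by (simp add: zC_def qr)
  also have "\<dots> \<in> wspan N b h (Suc n)"
    using assms qr by (intro wspan.add wspan_diff[of "_ - _" N b h "Suc n"] H_commute_mod) auto
  finally show ?thesis .
qed

lemma zC_prod_rotate_mod:
  assumes "set (q # ps) \<subseteq> {..<N} \<times> {..<N}"
  shows "foldr (zC N b) (ps @ [q]) h - foldr (zC N b) (q # ps) h \<in> lower N b h (Suc (length ps))"
  using assms
proof (induction ps)
  case (Cons r ps)
  let ?z = "foldr (zC N b) ps h"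
  have qr: "q \<in> {..<N} \<times> {..<N}" "r \<in> {..<N} \<times> {..<N}" using Cons.prems by simp_all
  have "foldr (zC N b) (ps @ [q]) h - zC N b q ?z \<in> lower N b h (Suc (length ps))"
    using Cons by simp
  from zC_lower[OF this qr(2)]
  have 1: "foldr (zC N b) ((r # ps) @ [q]) h - zC N b r (zC N b q ?z)
      \<in> lower N b h (Suc (Suc (length ps)))"
    by (simp add: zC_diff)
  have "zC N b r (zC N b q ?z) - zC N b q (zC N b r ?z)
      \<in> lower N b h (Suc (Suc (length ps)))"
    using Cons.prems qr unfolding lower_Suc
    by (intro zC_commute_mod zC_prod_wspan) auto
  from lower_trans[OF 1 this] show ?case by simp
qed (simp add: lower_0)

lemma zC_prod_rev_mod:
  assumes "set ps \<subseteq> {..<N} \<times> {..<N}"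
  shows "foldr (zC N b) (rev ps) h - foldr (zC N b) ps h \<in> lower N b h (length ps)"
  using assms
proof (induction ps)
  case (Cons q ps)
  have 1: "foldr (zC N b) (rev ps @ [q]) h - foldr (zC N b) (q # rev ps) h
      \<in> lower N b h (Suc (length ps))"
    using zC_prod_rotate_mod[of q "rev ps"] Cons.prems by simp
  have "zC N b q (foldr (zC N b) (rev ps) h) - zC N b q (foldr (zC N b) ps h)
      \<in> lower N b h (Suc (length ps))"
    unfolding zC_diff[symmetric] using Cons by (intro zC_lower) auto
  from lower_trans[OF 1[unfolded foldr.simps o_apply] this] show ?case by simp
qed (simp add: lower_0)

text \<open>The constants \<open>c\<close> and \<open>d\<close> are unrelated because they enter
  only below the top length. The reversal is the one produced by passing to the adjoint product in
  \<open>ip_yC_prod\<close>.\<close>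

lemma yC_prod_rev_mod:
  assumes "set ps \<subseteq> {..<N} \<times> {..<N}"
  shows "foldr (yC N b c) (rev ps) h - foldr (yC N b d) ps h \<in> lower N b h (length ps)"
proof -
  have "foldr (yC N b c) (rev ps) h - foldr (zC N b) (rev ps) h \<in> lower N b h (length ps)"
    using yC_prod_mod[of "rev ps" c] assms by simp
  moreover have "foldr (zC N b) ps h - foldr (yC N b d) ps h \<in> lower N b h (length ps)"
    using lower_diff[OF lower_0 yC_prod_mod[OF assms, of d]] by simp
  ultimately show ?thesis
    using zC_prod_rev_mod[OF assms] lower_trans by blast
qed

end

section \<open>The Gaussian functional\<close>

definition mon :: "nat \<Rightarrow> (nat \<Rightarrow> nat) \<Rightarrow> cpoly" where
  "mon M \<alpha> = (\<Prod>i<M. X i ^ \<alpha> i)"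

lemma mon_split: "j < M \<Longrightarrow> mon M \<alpha> = X j ^ \<alpha> j * (\<Prod>i\<in>{..<M}-{j}. X i ^ \<alpha> i)"
  unfolding mon_def by (rule prod.remove) auto

lemma mon_fun_upd: "j < M \<Longrightarrow> mon M (\<alpha>(j := a)) = X j ^ a * (\<Prod>i\<in>{..<M}-{j}. X i ^ \<alpha> i)"
  by (simp add: mon_split[of j])

lemma X_mult_mon: "j < M \<Longrightarrow> X j * mon M \<alpha> = mon M (\<alpha>(j := Suc (\<alpha> j)))"
  by (simp add: mon_fun_upd) (simp add: mon_split[of j])

lemma mon_extend: "M \<le> M' \<Longrightarrow> mon M \<alpha> = mon M' (\<lambda>i. if i < M then \<alpha> i else 0)"
  unfolding mon_def by (rule prod.mono_neutral_cong_left) auto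

text \<open>A \<open>cpoly\<close> may involve variables of index \<open>N\<close> and above, so
  monomials in any number \<open>M \<ge> N\<close> of variables are allowed.\<close>

inductive_set mon_span :: "nat \<Rightarrow> cpoly set" for N where
  mon: "N \<le> M \<Longrightarrow> cst c * mon M \<alpha> \<in> mon_span N"
| add: "p \<in> mon_span N \<Longrightarrow> q \<in> mon_span N \<Longrightarrow> p + q \<in> mon_span N"

lemma cst_mult_mon_span: "q \<in> mon_span N \<Longrightarrow> cst a * q \<in> mon_span N"
proof (induction rule: mon_span.induct)
  case (mon M c \<alpha>)
  then show ?case
    using mon_span.mon[of N M "a * c" \<alpha>] by (simp add: cst_simps mult.assoc)
qed (simp add: distrib_left mon_span.add)

lemma X_mult_mon_span: "q \<in> mon_span N \<Longrightarrow> X i * q \<in> mon_span N"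
proof (induction rule: mon_span.induct)
  case (mon M c \<alpha>)
  let ?M = "max M (Suc i)" and ?\<alpha> = "\<lambda>i. if i < M then \<alpha> i else 0"
  have "X i * (cst c * mon M \<alpha>) = cst c * (X i * mon ?M ?\<alpha>)"
    using mon_extend[of M ?M \<alpha>] by (simp add: mult.left_commute)
  also have "X i * mon ?M ?\<alpha> = mon ?M (?\<alpha>(i := Suc (?\<alpha> i)))"
    by (rule X_mult_mon) simp
  finally show ?case
    using mon mon_span.mon[of N ?M c "?\<alpha>(i := Suc (?\<alpha> i))"] by simp
qed (simp add: distrib_left mon_span.add)

lemma mult_mon_span: "q \<in> mon_span N \<Longrightarrow> p * q \<in> mon_span N"
  by (induction p arbitrary: q rule: cpoly_induct)
    (simp_all add: cst_mult_mon_span X_mult_mon_span mon_span.add distrib_right mult.assoc)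

text \<open>The span of the monomials absorbs multiplication by every polynomial and contains
  \<open>1\<close>, hence is everything.\<close>

lemma cpoly_mon_induct [case_names mon add]:
  assumes "\<And>c M \<alpha>. N \<le> M \<Longrightarrow> P (cst c * mon M \<alpha>)"
    and "\<And>p q. P p \<Longrightarrow> P q \<Longrightarrow> P (p + q)"
  shows "P p"
proof -
  have "1 \<in> mon_span N"
    using mon_span.mon[of N N 1 "\<lambda>_. 0"] by (simp add: mon_def cst_simps)
  then have "p \<in> mon_span N"
    using mult_mon_span[of 1 N p] by simp
  then show ?thesis by (induction rule: mon_span.induct) (use assms in auto)
qed

section \<open>Gaussian moments and integrals of monomials\<close>

definition moment :: "nat \<Rightarrow> real" where
  "moment a = (\<integral>x. exp (- x\<^sup>2) * x ^ a \<partial>lborel)"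

lemma gaussian_moment_even:
  "has_bochner_integral lborel (\<lambda>x::real. exp (- x\<^sup>2) * x ^ (2 * k))
    (sqrt pi * (fact (2 * k) / (2 ^ (2 * k) * fact k)))"
  using has_bochner_integral_even_function[OF gaussian_moment_even_pos[where k = k]] by simp

lemma gaussian_moment_odd:
  "has_bochner_integral lborel (\<lambda>x::real. exp (- x\<^sup>2) * x ^ (2 * k + 1)) 0"
  using has_bochner_integral_odd_function[OF gaussian_moment_odd_pos[where k = k]] by simp

lemma gaussian_moment_integrable: "integrable lborel (\<lambda>x::real. exp (- x\<^sup>2) * x ^ a)"
proof (cases "even a")
  case True
  then obtain k where "a = 2 * k" by (elim evenE)
  then show ?thesis using gaussian_moment_even[of k, THEN integrable.intros] by simp
next
  case False
  then obtain k where "a = 2 * k + 1" by (elim oddE)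
  then show ?thesis using gaussian_moment_odd[of k, THEN integrable.intros] by simp
qed

text \<open>Integration by parts in one variable, read off from the closed form of the even moments
  and the vanishing of the odd ones. For \<open>a = 0\<close> the truncated index
  \<open>a - 1\<close> is harmless since its coefficient is zero.\<close>

lemma moment_Suc: "2 * moment (Suc a) = real a * moment (a - 1)"
proof (cases "even a")
  case True
  then obtain k where a: "a = 2 * k" by (elim evenE)
  have "moment (Suc a) = 0"
    using gaussian_moment_odd[of k] by (simp add: moment_def a has_bochner_integral_iff)
  moreover have "real a * moment (a - 1) = 0"
  proof (cases k)
    case (Suc l)
    then show ?thesis
      using gaussian_moment_odd[of l] by (simp add: moment_def a has_bochner_integral_iff)
  qed (simp add: a)
  ultimately show ?thesis by simp
next
  case False
  then obtain k where a: "a = 2 * k + 1" by (elim oddE)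
  have m1: "moment (Suc a) = sqrt pi * (fact (2 * Suc k) / (2 ^ (2 * Suc k) * fact (Suc k)))"
    using gaussian_moment_even[of "Suc k"] unfolding moment_def a has_bochner_integral_iff by simp
  have m2: "moment (a - 1) = sqrt pi * (fact (2 * k) / (2 ^ (2 * k) * fact k))"
    using gaussian_moment_even[of k] unfolding moment_def a has_bochner_integral_iff by simp
  \<comment> \<open>The quotient of the two closed forms, with \<open>s\<close> for
    \<open>sqrt pi\<close>, \<open>K\<close> for \<open>k + 1\<close>, \<open>m\<close> for
    \<open>a\<close>, \<open>F\<close> for \<open>fact (2 * k)\<close>, \<open>P\<close> for
    \<open>2 ^ (2 * k)\<close> and \<open>G\<close> for \<open>fact k\<close>.\<close>
  have "2 * (s * (2 * K * m * F / (4 * P * (K * G)))) = m * (s * (F / (P * G)))"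
    if "K \<noteq> 0" for s K m F P G :: real
    using that by (simp add: mult_ac)
  moreover have "fact (2 * Suc k) = 2 * (real k + 1) * real a * fact (2 * k)"
    by (simp add: a algebra_simps)
  moreover have "(2::real) ^ (2 * Suc k) = 4 * 2 ^ (2 * k)" "fact (Suc k) = (real k + 1) * fact k"
    by simp_all
  ultimately show ?thesis
    unfolding m1 m2 by (simp only:)
qed

definition gauss :: "nat \<Rightarrow> (nat \<Rightarrow> real) \<Rightarrow> real" where
  "gauss N x = (\<Prod>i<N. exp (- (x i)\<^sup>2))"

text \<open>Only the Gaussian is kept as weight; the Vandermonde part of the squared ground state
  moves into the polynomial argument (see \<open>W\<close> and \<open>ip\<close>).\<close>

definition E :: "nat \<Rightarrow> cpoly \<Rightarrow> complex" where
  "E N p = (\<integral>x. peval p x * complex_of_real (gauss N x) \<partial>(Pi\<^sub>M {..<N} (\<lambda>_. lborel)))"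

context
  fixes N M :: nat and \<alpha> :: "nat \<Rightarrow> nat"
  assumes NM: "N \<le> M"
begin

text \<open>In \<^term>\<open>Pi\<^sub>M {..<N} (\<lambda>_. lborel)\<close> the coordinates \<open>x i\<close> with \<open>i \<ge> N\<close> have the fixed value
  \<^term>\<open>undefined\<close>.\<close>

private lemma mon_gauss_eq:
  assumes "x \<in> space (Pi\<^sub>M {..<N} (\<lambda>_. lborel :: real measure))"
  shows "peval (mon M \<alpha>) x * complex_of_real (gauss N x)
    = complex_of_real ((\<Prod>i\<in>{N..<M}. undefined ^ \<alpha> i) * (\<Prod>i<N. exp (- (x i)\<^sup>2) * x i ^ \<alpha> i))"
proof -
  have undef: "x i = undefined" if "i \<ge> N" for i
    using assms that PiE_arb[of x "{..<N}" "\<lambda>_. UNIV" i] by (simp add: space_PiM)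
  have "(\<Prod>i<M. x i ^ \<alpha> i) = (\<Prod>i\<in>{N..<M}. x i ^ \<alpha> i) * (\<Prod>i<N. x i ^ \<alpha> i)"
    using NM by (subst prod.union_disjoint[symmetric]) (auto intro: prod.cong)
  also have "(\<Prod>i\<in>{N..<M}. x i ^ \<alpha> i) = (\<Prod>i\<in>{N..<M}. undefined ^ \<alpha> i)"
    by (intro prod.cong refl) (subst undef; simp)
  finally have "peval (mon M \<alpha>) x
      = complex_of_real ((\<Prod>i\<in>{N..<M}. undefined ^ \<alpha> i) * (\<Prod>i<N. x i ^ \<alpha> i))"
    unfolding mon_def peval_prod peval_power peval_simps by (simp only: of_real_power[symmetric] of_real_prod[symmetric])
  then show ?thesis
    by (simp add: gauss_def prod.distrib mult_ac)
qed

interpretation product_sigma_finite "\<lambda>_ :: nat. lborel :: real measure"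
  by standard

lemma mon_gauss_integrable:
  "integrable (Pi\<^sub>M {..<N} (\<lambda>_. lborel)) (\<lambda>x. peval (mon M \<alpha>) x * complex_of_real (gauss N x))"
proof (subst Bochner_Integration.integrable_cong[OF refl mon_gauss_eq])
  have "integrable (Pi\<^sub>M {..<N} (\<lambda>_. lborel)) (\<lambda>x. \<Prod>i<N. exp (- (x i)\<^sup>2) * x i ^ \<alpha> i :: real)"
    by (rule product_integrable_prod) (auto intro: gaussian_moment_integrable)
  then show "integrable (Pi\<^sub>M {..<N} (\<lambda>_. lborel)) (\<lambda>x. complex_of_real
      ((\<Prod>i\<in>{N..<M}. undefined ^ \<alpha> i) * (\<Prod>i<N. exp (- (x i)\<^sup>2) * x i ^ \<alpha> i)))"
    by (intro integrable_of_real integrable_mult_right)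
qed

lemma E_mon:
  "E N (mon M \<alpha>)
    = complex_of_real ((\<Prod>i\<in>{N..<M}. undefined ^ \<alpha> i) * (\<Prod>i<N. moment (\<alpha> i)))"
proof -
  have "(\<integral>x. (\<Prod>i<N. exp (- (x i)\<^sup>2) * x i ^ \<alpha> i) \<partial>(Pi\<^sub>M {..<N} (\<lambda>_. lborel)))
      = (\<Prod>i<N. moment (\<alpha> i))"
    unfolding moment_def by (rule product_integral_prod) (auto intro: gaussian_moment_integrable)
  then show ?thesis
    unfolding E_def
    by (subst Bochner_Integration.integral_cong[OF refl mon_gauss_eq])
      (simp_all only: integral_complex_of_real integral_mult_right_zero)
qed

end

lemma peval_gauss_integrable:
  "integrable (Pi\<^sub>M {..<N} (\<lambda>_. lborel)) (\<lambda>x. peval p x * complex_of_real (gauss N x))"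
proof (induction p rule: cpoly_mon_induct[where N = N])
  case (mon c M \<alpha>)
  then show ?case
    using mon_gauss_integrable[OF mon, of \<alpha>] by (simp add: mult.assoc)
next
  case (add p q)
  then show ?case by (simp add: distrib_right)
qed

lemma E_add: "E N (p + q) = E N p + E N q"
  using peval_gauss_integrable[of N p] peval_gauss_integrable[of N q]
  by (simp add: E_def distrib_right)

lemma E_cst_mult: "E N (cst c * p) = c * E N p"
  by (simp add: E_def mult.assoc)

lemma E_diff: "E N (p - q) = E N p - E N q"
  using E_add[of N p "cst (- 1) * q"] by (simp add: E_cst_mult) (simp add: cst_simps)

text \<open>Checked on monomials instead of by a change of variables: the swap permutes exponents of
  index below \<open>N\<close>, which leaves the product of moments and the factors of index
  \<open>N\<close> and above unchanged.\<close>

lemma E_S: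
  assumes "i < N" "j < N"
  shows "E N (S i j p) = E N p"
proof (induction p rule: cpoly_mon_induct[where N = N])
  case (mon c M \<alpha>)
  have bij: "bij_betw (transpose i j) {..<K} {..<K}" if "N \<le> K" for K
    using assms that by (simp add: bij_betw_transpose_iff)
  have "S i j (mon M \<alpha>) = (\<Prod>k<M. X (transpose i j k) ^ \<alpha> (transpose i j (transpose i j k)))"
    by (simp add: mon_def S_prod S_power)
  also have "\<dots> = mon M (\<alpha> \<circ> transpose i j)"
    unfolding mon_def o_apply using bij[OF mon] by (rule prod.reindex_bij_betw)
  finally have "S i j (mon M \<alpha>) = mon M (\<alpha> \<circ> transpose i j)" .
  moreover have "(\<Prod>k<N. moment ((\<alpha> \<circ> transpose i j) k)) = (\<Prod>k<N. moment (\<alpha> k))"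
    unfolding o_apply using bij[OF order_refl] by (rule prod.reindex_bij_betw)
  moreover have "(\<Prod>k\<in>{N..<M}. undefined ^ (\<alpha> \<circ> transpose i j) k)
      = (\<Prod>k\<in>{N..<M}. undefined ^ \<alpha> k :: real)"
    using assms by (intro prod.cong) (auto simp: transpose_def)
  ultimately have "E N (S i j (mon M \<alpha>)) = E N (mon M \<alpha>)"
    by (simp only: E_mon[OF mon])
  then show ?case by (simp add: E_cst_mult)
qed (simp add: E_add)

lemma cst_of_nat: "cst (of_nat n) = of_nat n"
  by (induction n) (simp_all add: cst_simps)

lemma pder_power: "pder j (p ^ n) = of_nat n * p ^ (n - 1) * pder j p"
proof (induction n)
  case (Suc n)
  show ?case
  proof (cases n)
    case 0
    then show ?thesis by simp
  next
    case (Suc k)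
    then show ?thesis using Suc.IH by (simp add: pder_mult algebra_simps)
  qed
qed simp

lemma pder_mon:
  assumes "j < M"
  shows "pder j (mon M \<alpha>) = cst (of_nat (\<alpha> j)) * mon M (\<alpha>(j := \<alpha> j - 1))"
proof -
  have "pder j (\<Prod>i\<in>A. X i ^ \<alpha> i) = 0" if "j \<notin> A" for A
    using that
    by (induction A rule: infinite_finite_induct)
      (auto simp: pder_mult pder_power pder_X)
  from this[of "{..<M}-{j}"] show ?thesis
    by (simp add: mon_fun_upd[OF assms] mon_split[OF assms] pder_mult pder_power pder_X cst_of_nat mult.assoc)
qed

text \<open>Integration by parts against the Gaussian. On monomials it reduces to
  \<open>moment_Suc\<close> in the coordinate \<open>j\<close>, the other moments being a common
  factor.\<close>

lemma E_pder:
  assumes "j < N"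
  shows "E N (pder j p) = 2 * E N (X j * p)"
proof (induction p rule: cpoly_mon_induct[where N = N])
  case (mon c M \<alpha>)
  have jM: "j < M" using assms mon by simp
  let ?R = "(\<Prod>i\<in>{N..<M}. undefined ^ \<alpha> i) * (\<Prod>i\<in>{..<N}-{j}. moment (\<alpha> i))"
  have upd: "E N (mon M (\<alpha>(j := a))) = complex_of_real (?R * moment a)" for a
  proof -
    have "(\<Prod>i<N. moment ((\<alpha>(j := a)) i)) = moment a * (\<Prod>i\<in>{..<N}-{j}. moment (\<alpha> i))"
      using assms by (subst prod.remove[of _ j]) auto
    moreover have "(\<Prod>i\<in>{N..<M}. undefined ^ (\<alpha>(j := a)) i)
        = (\<Prod>i\<in>{N..<M}. undefined ^ \<alpha> i :: real)"
      using assms by (intro prod.cong) auto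
    ultimately show ?thesis
      using E_mon[OF mon, of "\<alpha>(j := a)"] by (simp only:) (simp add: mult_ac)
  qed
  have "X j * (cst c * mon M \<alpha>) = cst c * mon M (\<alpha>(j := Suc (\<alpha> j)))"
    by (simp only: X_mult_mon[OF jM, symmetric] mult.left_commute[of "X j"])
  then have "2 * E N (X j * (cst c * mon M \<alpha>)) = c * complex_of_real (?R * (2 * moment (Suc (\<alpha> j))))"
    by (simp add: E_cst_mult upd)
  also have "\<dots> = E N (pder j (cst c * mon M \<alpha>))"
    unfolding moment_Suc by (simp add: pder_mon[OF jM] E_cst_mult upd)
  finally show ?case ..
qed (simp add: E_add distrib_left)

section \<open>The weighted pairing\<close>

definition pairs :: "nat \<Rightarrow> (nat \<times> nat) set" where
  "pairs N = (SIGMA i:{..<N}. {i<..<N})"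

definition V :: "nat \<Rightarrow> cpoly" where
  "V N = (\<Prod>(i, j)\<in>pairs N. X i - X j)"

lemma finite_pairs [simp]: "finite (pairs N)"
  by (simp add: pairs_def)

lemma mem_pairs [simp]: "(i, j) \<in> pairs N \<longleftrightarrow> i < j \<and> j < N"
  by (auto simp: pairs_def)

text \<open>An adjacent transposition reverses only the pair \<open>(a, Suc a)\<close> and permutes
  the other ordered pairs, so exactly one factor changes sign.\<close>

lemma S_V_adjacent:
  assumes "Suc a < N"
  shows "S a (Suc a) (V N) = - V N"
proof -
  let ?t = "transpose a (Suc a)" and ?P = "pairs N - {(a, Suc a)}"
  have V: "V N = (X a - X (Suc a)) * (\<Prod>(i, j)\<in>?P. X i - X j)"
    unfolding V_def using assms by (subst prod.remove[of _ "(a, Suc a)"]) auto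
  have lt: "map_prod ?t ?t q \<in> ?P" if "q \<in> ?P" for q
    using that assms by (cases q) (auto simp: transpose_def)
  have bij: "bij_betw (map_prod ?t ?t) ?P ?P"
  proof (rule bij_betw_byWitness[where f' = "map_prod ?t ?t"])
    show "map_prod ?t ?t ` ?P \<subseteq> ?P" "map_prod ?t ?t ` ?P \<subseteq> ?P"
      by (rule image_subsetI, erule lt)+
  qed auto
  have "(\<Prod>q\<in>?P. S a (Suc a) (case q of (i, j) \<Rightarrow> X i - X j))
      = (\<Prod>q\<in>?P. case map_prod ?t ?t q of (i, j) \<Rightarrow> X i - X j)"
    by (intro prod.cong) auto
  also have "\<dots> = (\<Prod>(i, j)\<in>?P. X i - X j)"
    by (rule prod.reindex_bij_betw[OF bij])
  finally have "S a (Suc a) (V N) = (X (Suc a) - X a) * (\<Prod>(i, j)\<in>?P. X i - X j)"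
    by (simp add: V S_prod)
  then show ?thesis by (simp add: V flip: mult_minus_left)
qed

lemma S_V_less: "a < b \<Longrightarrow> b < N \<Longrightarrow> S a b (V N) = - V N"
proof (induction b)
  case (Suc b)
  show ?case
  proof (cases "a = b")
    case False
    then have t: "transpose b (Suc b) a = a" using Suc.prems by (simp add: transpose_def)
    \<comment> \<open>\<open>s_{a,b+1}\<close> is the conjugate of \<open>s_{a,b}\<close> by the
      adjacent \<open>s_{b,b+1}\<close>, so three signs are collected.\<close>
    have "S a (Suc b) (V N) = S a (Suc b) (S b (Suc b) (S b (Suc b) (V N)))"
      by simp
    also have "\<dots> = S b (Suc b) (S a b (S b (Suc b) (V N)))"
      using S_conj[of b "Suc b" a b "S b (Suc b) (V N)"] t by simp
    also have "\<dots> = - V N"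
      using Suc False by (simp add: S_V_adjacent)
    finally show ?thesis .
  qed (use Suc.prems S_V_adjacent in simp)
qed simp

lemma S_V: "a < N \<Longrightarrow> b < N \<Longrightarrow> a \<noteq> b \<Longrightarrow> S a b (V N) = - V N"
  using S_V_less[of a b N] S_V_less[of b a N] S_commute[of a b] by (metis nat_neq_iff)

lemma pder_prod:
  "finite A \<Longrightarrow> pder j (\<Prod>q\<in>A. F q) = (\<Sum>q\<in>A. pder j (F q) * (\<Prod>r\<in>A-{q}. F r))"
proof (induction A rule: finite_induct)
  case (insert a A)
  have "(\<Sum>q\<in>A. pder j (F q) * (\<Prod>r\<in>insert a A - {q}. F r))
      = (\<Sum>q\<in>A. F a * (pder j (F q) * (\<Prod>r\<in>A - {q}. F r)))"
  proof (intro sum.cong refl)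
    fix q assume "q \<in> A"
    then have "insert a A - {q} = insert a (A - {q})" using insert by auto
    then show "pder j (F q) * (\<Prod>r\<in>insert a A - {q}. F r)
        = F a * (pder j (F q) * (\<Prod>r\<in>A - {q}. F r))"
      using insert by (simp add: mult.left_commute)
  qed
  then show ?case
    using insert by (simp add: pder_mult sum_distrib_left)
qed simp

text \<open>The logarithmic derivative of the Vandermonde product: \<open>U k\<close> plays the role
  of \<open>V / (x_j - x_k)\<close>.\<close>

lemma pder_V:
  assumes "j < N"
  obtains U where "pder j (V N) = (\<Sum>k\<in>{..<N}-{j}. U k)"
    and "\<And>k. k \<in> {..<N}-{j} \<Longrightarrow> (X j - X k) * U k = V N"
proof
  define F where "F = (\<lambda>(i, k). X i - X k :: cpoly)"
  define pr where "pr k = (min j k, max j k)" for k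
  \<comment> \<open>The derivative of the removed factor is 1 or -1 according to whether
    \<open>j\<close> is the smaller or the larger index, which corrects the orientation of the
    pair.\<close>
  define U where "U k = pder j (F (pr k)) * (\<Prod>q\<in>pairs N - {pr k}. F q)" for k
  let ?K = "{..<N} - {j}"
  have inj: "inj_on pr ?K"
    by (auto simp: inj_on_def pr_def min_def max_def split: if_splits)
  have sub: "pr ` ?K \<subseteq> pairs N"
    using assms by (auto simp: pr_def split: split_min split_max)
  have zero: "pder j (F q) = 0" if "q \<in> pairs N - pr ` ?K" for q
  proof (cases q)
    case (Pair i k)
    have "j \<noteq> i"
    proof
      assume "j = i"
      then have "q = pr k" "k \<in> ?K" using that Pair by (auto simp: pr_def)
      then show False using that by blast
    qed
    moreover have "j \<noteq> k"
    proof
      assume "j = k"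
      then have "q = pr i" "i \<in> ?K" using that Pair by (auto simp: pr_def)
      then show False using that by blast
    qed
    ultimately show ?thesis by (simp add: Pair F_def pder_X)
  qed
  have "pder j (V N) = (\<Sum>q\<in>pairs N. pder j (F q) * (\<Prod>r\<in>pairs N-{q}. F r))"
    unfolding V_def F_def by (rule pder_prod) simp
  also have "\<dots> = (\<Sum>q\<in>pr ` ?K. pder j (F q) * (\<Prod>r\<in>pairs N-{q}. F r))"
    using sub zero by (intro sum.mono_neutral_right) auto
  also have "\<dots> = (\<Sum>k\<in>?K. U k)"
    unfolding U_def by (simp add: sum.reindex[OF inj])
  finally show "pder j (V N) = (\<Sum>k\<in>?K. U k)" .
  fix k assume k: "k \<in> ?K"
  have "(X j - X k) * pder j (F (pr k)) = F (pr k)"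
    using k by (auto simp: F_def pr_def min_def max_def pder_X)
  then have "(X j - X k) * U k = F (pr k) * (\<Prod>q\<in>pairs N - {pr k}. F q)"
    by (simp add: U_def flip: mult.assoc)
  also have "\<dots> = V N"
    unfolding V_def F_def[symmetric] using sub k by (intro prod.remove[symmetric]) auto
  finally show "(X j - X k) * U k = V N" .
qed

text \<open>The even exponent absorbs the absolute values of \<open>phiA\<close>, so the weight is a
  polynomial times a Gaussian.\<close>

definition W :: "nat \<Rightarrow> nat \<Rightarrow> cpoly" where
  "W N \<beta> = V N ^ (2 * \<beta>)"

lemma S_W: "a < N \<Longrightarrow> b < N \<Longrightarrow> S a b (W N \<beta>) = W N \<beta>"
  by (cases "a = b") (simp_all add: W_def S_power S_V)

text \<open>\<open>U k\<close> stands for \<open>W / (x_j - x_k)\<close>, antisymmetric under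
  \<open>S j k\<close> since \<open>W\<close> is symmetric. For \<open>\<beta> = 0\<close> the
  weight is \<open>1\<close> and this quotient is no polynomial; the factor
  \<open>of_nat \<beta>\<close> lets \<open>U = 0\<close> serve there.\<close>

lemma pder_W:
  assumes "j < N"
  obtains U where "pder j (W N \<beta>) = 2 * of_nat \<beta> * (\<Sum>k\<in>{..<N}-{j}. U k)"
    and "\<And>k. k \<in> {..<N}-{j} \<Longrightarrow> of_nat \<beta> * W N \<beta> = of_nat \<beta> * ((X j - X k) * U k)"
    and "\<And>k. k \<in> {..<N}-{j} \<Longrightarrow> S j k (U k) = - U k"
proof (cases \<beta>)
  case 0
  then show ?thesis using that[of "\<lambda>_. 0"] by (simp add: W_def)
next
  case (Suc n)
  obtain U where U: "pder j (V N) = (\<Sum>k\<in>{..<N}-{j}. U k)"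
    and XU: "\<And>k. k \<in> {..<N}-{j} \<Longrightarrow> (X j - X k) * U k = V N"
    using pder_V[OF assms] by blast
  \<comment> \<open>With \<open>\<beta> = n + 1\<close>, one of the \<open>2 * \<beta>\<close>
    Vandermonde factors is replaced by its quotient by \<open>x_j - x_k\<close>, leaving the
    exponent \<open>2 * n + 1\<close>.\<close>
  define U' where "U' k = V N ^ (2 * n + 1) * U k" for k
  have XU': "(X j - X k) * U' k = W N \<beta>" if "k \<in> {..<N}-{j}" for k
  proof -
    have "(X j - X k) * U' k = V N ^ (2 * n + 1) * ((X j - X k) * U k)"
      by (simp only: U'_def mult.left_commute)
    also have "\<dots> = W N \<beta>"
      unfolding XU[OF that] by (simp add: W_def Suc)
    finally show ?thesis .
  qed
  show ?thesis
  proof (rule that[of U'])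
    have "pder j (W N \<beta>) = 2 * of_nat \<beta> * V N ^ (2 * n + 1) * pder j (V N)"
      unfolding W_def pder_power by (simp add: Suc)
    then show "pder j (W N \<beta>) = 2 * of_nat \<beta> * (\<Sum>k\<in>{..<N}-{j}. U' k)"
      unfolding U U'_def by (simp only: sum_distrib_left mult.assoc)
  next
    fix k assume k: "k \<in> {..<N}-{j}"
    show "of_nat \<beta> * W N \<beta> = of_nat \<beta> * ((X j - X k) * U' k)"
      by (simp only: XU'[OF k])
    have "(X k - X j) * S j k (U' k) = S j k ((X j - X k) * U' k)"
      by simp
    also have "\<dots> = (X j - X k) * U' k"
      unfolding XU'[OF k] using assms k by (simp add: S_W)
    finally have "(X k - X j) * S j k (U' k) = (X j - X k) * U' k" .
    from arg_cong[OF this, of uminus]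
    have "(X j - X k) * S j k (U' k) = (X j - X k) * (- U' k)"
      by (simp flip: mult_minus_left)
    then show "S j k (U' k) = - U' k"
      by (rule X_diff_cancel[rotated]) (use k in auto)
  qed
qed

section \<open>Adjoints in the weighted pairing\<close>

definition ip :: "nat \<Rightarrow> nat \<Rightarrow> cpoly \<Rightarrow> cpoly \<Rightarrow> complex" where
  "ip N \<beta> p q = E N (p * q * W N \<beta>)"

lemma ip_commute: "ip N \<beta> p q = ip N \<beta> q p"
  by (simp add: ip_def mult.commute)

lemma ip_linear:
  "ip N \<beta> (p + p') q = ip N \<beta> p q + ip N \<beta> p' q"
  "ip N \<beta> (p - p') q = ip N \<beta> p q - ip N \<beta> p' q"
  "ip N \<beta> (cst c * p) q = c * ip N \<beta> p q"
  "ip N \<beta> p (q + q') = ip N \<beta> p q + ip N \<beta> p q'"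
  "ip N \<beta> p (q - q') = ip N \<beta> p q - ip N \<beta> p q'"
  "ip N \<beta> p (cst c * q) = c * ip N \<beta> p q"
  by (simp_all add: ip_def E_add E_diff E_cst_mult distrib_left distrib_right left_diff_distrib
      right_diff_distrib mult.assoc mult.left_commute[of p "cst c"])

lemma E_sum: "E N (sum f A) = (\<Sum>x\<in>A. E N (f x))"
proof (induction A rule: infinite_finite_induct)
  case (insert x A)
  then show ?case by (simp add: E_add)
qed (use E_cst_mult[of N 0 0] in \<open>simp_all add: cst_simps\<close>)

lemma ip_sum:
  "ip N \<beta> (sum f A) q = (\<Sum>x\<in>A. ip N \<beta> (f x) q)"
  "ip N \<beta> q (sum f A) = (\<Sum>x\<in>A. ip N \<beta> q (f x))"
  by (simp_all add: ip_def E_sum sum_distrib_left sum_distrib_right)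

lemma ip_S:
  assumes "i < N" "j < N"
  shows "ip N \<beta> (S i j p) q = ip N \<beta> p (S i j q)"
proof -
  have "E N (S i j p * q * W N \<beta>) = E N (S i j (S i j p * q * W N \<beta>))"
    by (rule E_S[OF assms, symmetric])
  then show ?thesis using assms by (simp add: ip_def S_W)
qed

text \<open>The terms \<open>A k\<close> left over by the integration by parts change sign under \<open>S j k\<close>, so they
  integrate to zero.\<close>

lemma ip_Du:
  assumes "j < N"
  shows "ip N \<beta> (Du N (of_nat \<beta>) j p) q + ip N \<beta> p (Du N (of_nat \<beta>) j q) = 2 * ip N \<beta> (X j * p) q"
proof -
  let ?K = "{..<N}-{j}" and ?W = "W N \<beta>" and ?b = "of_nat \<beta> :: cpoly"
  obtain U where U: "pder j ?W = 2 * ?b * (\<Sum>k\<in>?K. U k)"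
    and bW: "\<And>k. k \<in> ?K \<Longrightarrow> ?b * ?W = ?b * ((X j - X k) * U k)"
    and SU: "\<And>k. k \<in> ?K \<Longrightarrow> S j k (U k) = - U k"
    using pder_W[OF assms] by blast
  define A where "A k = (S j k p * q + p * S j k q) * U k" for k
  have dd_W: "?b * dd j k r * ?W = ?b * (r - S j k r) * U k" if "k \<in> ?K" for k r
  proof -
    have "?b * dd j k r * ?W = (?b * ?W) * dd j k r"
      by (simp only: mult_ac)
    also have "\<dots> = ?b * ((X j - X k) * dd j k r) * U k"
      unfolding bW[OF that] by (simp only: mult_ac)
    finally show ?thesis by (simp only: dd)
  qed
  have Du_W: "Du N (of_nat \<beta>) j r * ?W = pder j r * ?W + (\<Sum>k\<in>?K. ?b * (r - S j k r) * U k)" for r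
  proof -
    have "Du N (of_nat \<beta>) j r * ?W = pder j r * ?W + (\<Sum>k\<in>?K. ?b * dd j k r * ?W)"
      by (simp add: Du_def cst_of_nat distrib_right sum_distrib_left sum_distrib_right)
    also have "(\<Sum>k\<in>?K. ?b * dd j k r * ?W) = (\<Sum>k\<in>?K. ?b * (r - S j k r) * U k)"
      by (intro sum.cong refl dd_W)
    finally show ?thesis .
  qed
  have "Du N (of_nat \<beta>) j p * q * ?W + p * Du N (of_nat \<beta>) j q * ?W
      = q * (Du N (of_nat \<beta>) j p * ?W) + p * (Du N (of_nat \<beta>) j q * ?W)"
    by (simp only: mult_ac)
  also have "\<dots> = pder j p * q * ?W + p * pder j q * ?W
      + (\<Sum>k\<in>?K. q * (?b * (p - S j k p) * U k) + p * (?b * (q - S j k q) * U k))"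
    unfolding Du_W by (simp add: distrib_left sum.distrib sum_distrib_left mult_ac)
  \<comment> \<open>\<open>q (p - s p) + p (q - s q)\<close> is \<open>2 p q\<close> minus the part
    collected in \<open>A\<close>; the factor 2 is the one in \<open>pder j W\<close>, so the
    Leibniz rule for \<open>p * q * W\<close> becomes complete.\<close>
  also have "(\<Sum>k\<in>?K. q * (?b * (p - S j k p) * U k) + p * (?b * (q - S j k q) * U k))
      = (\<Sum>k\<in>?K. p * q * (2 * ?b * U k) - ?b * A k)"
    by (intro sum.cong refl) (simp add: A_def algebra_simps)
  also have "\<dots> = p * q * pder j ?W - (\<Sum>k\<in>?K. ?b * A k)"
    unfolding U by (simp add: sum_subtractf sum_distrib_left mult.assoc)
  finally have "Du N (of_nat \<beta>) j p * q * ?W + p * Du N (of_nat \<beta>) j q * ?W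
      = pder j (p * q * ?W) - (\<Sum>k\<in>?K. ?b * A k)"
    by (simp add: pder_mult algebra_simps)
  moreover have "E N (\<Sum>k\<in>?K. ?b * A k) = 0"
  proof -
    have "E N (?b * A k) = 0" if "k \<in> ?K" for k
    proof -
      have "S j k (A k) = cst (- 1) * A k"
        using SU[OF that] by (simp add: A_def cst_simps algebra_simps)
      then have "E N (A k) = - E N (A k)"
        using E_S[of j N k "A k"] assms that by (simp add: E_cst_mult)
      then show ?thesis by (simp add: E_cst_mult flip: cst_of_nat)
    qed
    then show ?thesis by (simp add: E_sum)
  qed
  ultimately have "ip N \<beta> (Du N (of_nat \<beta>) j p) q + ip N \<beta> p (Du N (of_nat \<beta>) j q)
      = E N (pder j (p * q * ?W))"
    unfolding ip_def by (simp add: E_diff flip: E_add)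
  then show ?thesis
    by (simp add: E_pder[OF assms] ip_def mult.assoc)
qed

text \<open>Applying \<open>ip_Du\<close> to \<open>D p\<close> and \<open>q\<close> produces half
  the pairing of \<open>D (D p)\<close> with \<open>q\<close>, which cancels the second-order term
  of \<open>H\<close>. The remaining expression is symmetric in \<open>p\<close> and
  \<open>q\<close>, which gives self-adjointness.\<close>

lemma ip_H_eq:
  assumes "j < N"
  shows "ip N \<beta> (H N (of_nat \<beta>) j p) q
    = ip N \<beta> (Du N (of_nat \<beta>) j p) (Du N (of_nat \<beta>) j q) / 2"
proof -
  let ?D = "Du N (of_nat \<beta>) j"
  have "ip N \<beta> (X j * ?D p) q = (ip N \<beta> (?D (?D p)) q + ip N \<beta> (?D p) (?D q)) / 2"
    unfolding ip_Du[OF assms] by simp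
  then show ?thesis by (simp add: H_def ip_linear add_divide_distrib)
qed

lemma ip_H: "j < N \<Longrightarrow> ip N \<beta> (H N (of_nat \<beta>) j p) q = ip N \<beta> p (H N (of_nat \<beta>) j q)"
  by (metis ip_H_eq ip_commute)

lemma ip_hC: "j < N \<Longrightarrow> ip N \<beta> (hC N (of_nat \<beta>) j p) q = ip N \<beta> p (hC N (of_nat \<beta>) j q)"
  by (simp add: hC_def ip_linear ip_sum ip_H ip_S)

lemma ip_yC:
  "r \<in> {..<N} \<times> {..<N} \<Longrightarrow>
    ip N \<beta> (yC N (of_nat \<beta>) c r p) q = ip N \<beta> p (yC N (of_nat \<beta>) c r q)"
  by (auto simp: yC_def ip_linear ip_hC)

lemma ip_yC_prod:
  "set ps \<subseteq> {..<N} \<times> {..<N} \<Longrightarrow>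
    ip N \<beta> (foldr (yC N (of_nat \<beta>) c) ps p) q
      = ip N \<beta> p (foldr (yC N (of_nat \<beta>) c) (rev ps) q)"
  by (induction ps arbitrary: q) (simp_all add: ip_yC)

text \<open>The adjoint product has the reversed order and constant \<open>c\<close>; replacing it
  by the original order and \<open>d\<close> costs words strictly shorter than \<open>ps\<close>,
  which the transposition-invariant functional \<open>ip N \<beta> p\<close> kills.\<close>

lemma ip_yC_prod_sym_antisym:
  assumes "antisymmetric N h"
    and sym: "\<And>i j. i < N \<Longrightarrow> j < N \<Longrightarrow> S i j p = p"
    and ps: "set ps \<subseteq> {..<N} \<times> {..<N}" "length ps \<le> (\<Sum>i<N. i)"
  shows "ip N \<beta> (foldr (yC N (of_nat \<beta>) c) ps p) h
    = ip N \<beta> p (foldr (yC N (of_nat \<beta>) d) ps h)"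
proof -
  interpret antisymmetric N "of_nat \<beta>" h by fact
  have "ip N \<beta> p (foldr (yC N (of_nat \<beta>) c) (rev ps) h - foldr (yC N (of_nat \<beta>) d) ps h) = 0"
  proof (rule symmetric_functional_vanishes[where L = "ip N \<beta> p"])
    show "ip N \<beta> p (S i j u) = ip N \<beta> p u" if "i < N" "j < N" for i j u
      using that by (simp add: sym flip: ip_S)
  qed (use yC_prod_rev_mod ps in \<open>auto simp: ip_linear\<close>)
  then show ?thesis by (simp add: ip_yC_prod[OF ps(1)] ip_linear)
qed

section \<open>Passing from operators on functions to operators on polynomials\<close>

lemma set_index_pairs: "set (index_pairs N) \<subseteq> {..<N} \<times> {..<N}"
  by (auto simp: index_pairs_def)

lemma length_index_pairs: "length (index_pairs N) = (\<Sum>i<N. i)"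
proof -
  have "length (index_pairs N) = (\<Sum>i<N. N - Suc i)"
    by (simp add: index_pairs_def length_concat o_def interv_sum_list_conv_sum_set_nat atLeast0LessThan)
  also have "\<dots> = (\<Sum>i<N. i)"
    by (rule sum.nat_diff_reindex)
  finally show ?thesis .
qed

text \<open>At points with two equal coordinates the operators of the definitions follow the convention
  \<open>x / 0 = 0\<close>, unless the coupling vanishes and all quotients drop out.\<close>

definition regular :: "real \<Rightarrow> nat \<Rightarrow> (nat \<Rightarrow> real) \<Rightarrow> bool" where
  "regular b N x \<longleftrightarrow> b = 0 \<or> inj_on x {..<N}"

text \<open>Agreement at regular points suffices without any null-set argument: if \<open>b\<close>
  is a positive integer, the weight \<open>W\<close> vanishes at the other points, and if
  \<open>b = 0\<close> there are none.\<close>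

definition represents :: "real \<Rightarrow> nat \<Rightarrow> rfun \<Rightarrow> cpoly \<Rightarrow> bool" where
  "represents b N F p \<longleftrightarrow> (\<forall>x. regular b N x \<longrightarrow> F x = peval p x)"

lemma representsD: "represents b N F p \<Longrightarrow> regular b N x \<Longrightarrow> F x = peval p x"
  by (simp add: represents_def)

lemma regular_swapv:
  assumes "regular b N x" "i < N" "j < N"
  shows "regular b N (swapv i j x)"
proof -
  have "inj_on (x \<circ> transpose i j) {..<N}" if "inj_on x {..<N}"
    using that assms by (intro comp_inj_on) auto
  then show ?thesis using assms by (auto simp: regular_def swapv_eq_comp)
qed

text \<open>Regularity survives small changes of one coordinate, so \<open>pd j F\<close> at a
  regular point depends only on values of \<open>F\<close> at regular points.\<close>

lemma regular_fun_upd: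
  assumes "regular b N x" "j < N"
  shows "\<forall>\<^sub>F t in nhds (x j). regular b N (x(j := t))"
proof (cases "b = 0")
  case False
  then have inj: "inj_on x {..<N}" using assms by (simp add: regular_def)
  let ?A = "x ` ({..<N} - {j})"
  have "open (- ?A)"
    by (intro open_Compl finite_imp_closed) simp
  moreover have "x j \<in> - ?A"
    using inj assms by (auto simp: inj_on_def)
  ultimately have "\<forall>\<^sub>F t in nhds (x j). t \<in> - ?A"
    by (rule eventually_nhds_in_open)
  then show ?thesis
  proof eventually_elim
    case (elim t)
    then have "inj_on (x(j := t)) {..<N}"
      using inj by (auto simp: inj_on_def)
    then show ?case by (simp add: regular_def)
  qed
qed (simp add: regular_def)

lemma represents_pd:
  assumes "represents b N F p" "j < N" "regular b N x"
  shows "pd j F x = peval (pder j p) x"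
proof -
  have "\<forall>\<^sub>F t in nhds (x j). t \<in> UNIV \<longrightarrow> F (x(j := t)) = peval p (x(j := t))"
    using regular_fun_upd[OF assms(3,2)] by eventually_elim (use assms(1) in \<open>simp add: represents_def\<close>)
  then have "pd j F x = vector_derivative (\<lambda>t. peval p (x(j := t))) (at (x j))"
    unfolding pd_def by (rule vector_derivative_cong_eq) auto
  then show ?thesis
    by (simp only: vector_derivative_at[OF has_vector_derivative_pder])
qed

lemma represents_DA:
  assumes "represents b N F p" "j < N"
  shows "represents b N (DA N b j F) (Du N (complex_of_real b) j p)"
  unfolding represents_def
proof (intro allI impI)
  fix x assume x: "regular b N x"
  have "complex_of_real b * (\<Sum>k\<in>{..<N}-{j}. (F x - sw j k F x) / complex_of_real (x j - x k))
      = complex_of_real b * (\<Sum>k\<in>{..<N}-{j}. peval (dd j k p) x)"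
  proof (cases "b = 0")
    case False
    have "(F x - sw j k F x) / complex_of_real (x j - x k) = peval (dd j k p) x"
      if k: "k \<in> {..<N}-{j}" for k
    proof -
      have "x j \<noteq> x k"
        using x False k assms(2) by (auto simp: regular_def inj_on_def)
      moreover have "F x - sw j k F x = peval p x - peval p (swapv j k x)"
        using k assms x regular_swapv[OF x, of j k] by (simp add: sw_def representsD[OF assms(1)])
      moreover have "complex_of_real (x j - x k) * peval (dd j k p) x
          = peval p x - peval p (swapv j k x)"
        using arg_cong[OF dd[of j k p], of "\<lambda>q. peval q x"] by simp
      ultimately show ?thesis
        by (metis nonzero_mult_div_cancel_left of_real_eq_0_iff right_minus_eq)
    qed
    then show ?thesis by simp
  qed simp
  then show "DA N b j F x = peval (Du N (complex_of_real b) j p) x"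
    by (simp add: DA_def Du_def represents_pd[OF assms x])
qed

lemma represents_hA:
  assumes "represents b N F p" "j < N"
  shows "represents b N (hA N b j F) (hC N (complex_of_real b) j p)"
  unfolding represents_def
proof (intro allI impI)
  fix x assume x: "regular b N x"
  let ?D = "Du N (complex_of_real b) j" and ?s = "complex_of_real (sqrt 2)"
  have s: "?s * ?s = 2" by (simp flip: of_real_mult)
  have "represents b N (aop N b j F) (cst (1 / ?s) * ?D p)"
    using represents_DA[OF assms] by (simp add: represents_def aop_def)
  from this represents_DA[OF this assms(2)]
  have "adag N b j (aop N b j F) x
      = (- peval (?D (cst (1 / ?s) * ?D p)) x
          + 2 * complex_of_real (x j) * peval (cst (1 / ?s) * ?D p) x) / ?s"
    using x by (simp add: adag_def representsD)
  also have "\<dots> = (- peval (?D (?D p)) x + 2 * complex_of_real (x j) * peval (?D p) x) / (?s * ?s)"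
    unfolding Du_cst_mult peval_simps by (simp add: field_simps)
  also have "\<dots> = peval (H N (complex_of_real b) j p) x"
    unfolding s by (simp add: H_def field_simps)
  finally have adag: "adag N b j (aop N b j F) x = peval (H N (complex_of_real b) j p) x" .
  have "sw j k F x = peval p (swapv j k x)" if "k < j" for k
    using regular_swapv[OF x, of j k] that assms(2) by (simp add: sw_def representsD[OF assms(1)])
  then show "hA N b j F x = peval (hC N (complex_of_real b) j p) x"
    by (simp add: hA_def adag hC_def)
qed

lemma represents_yfactor:
  assumes "represents b N F p" "i < N" "j < N"
  shows "represents b N (yfactor N b c i j F)
    (yC N (complex_of_real b) (complex_of_real c) (i, j) p)"
  using assms represents_hA[OF assms(1)] by (simp add: represents_def yfactor_def yC_def)

lemma represents_Yop:
  assumes "represents b N F p"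
  shows "represents b N (Yop N b c F)
    (foldr (yC N (complex_of_real b) (complex_of_real c)) (index_pairs N) p)"
proof -
  \<comment> \<open>\<open>Yop\<close> folds in the space of operators; the name \<open>step\<close>
    keeps its body closed so that the induction can turn composition into application, as in the
    fold of \<open>yC\<close>.\<close>
  define step :: "nat \<times> nat \<Rightarrow> (rfun \<Rightarrow> rfun) \<Rightarrow> rfun \<Rightarrow> rfun"
    where "step = (\<lambda>(i, j) T. yfactor N b c i j \<circ> T)"
  have step: "step (i, j) T F = yfactor N b c i j (T F)" for i j T F
    by (simp add: step_def)
  let ?y = "yC N (complex_of_real b) (complex_of_real c)"
  have "represents b N (foldr step ps id F) (foldr ?y ps p)" if "set ps \<subseteq> {..<N} \<times> {..<N}" for ps
    using that
  proof (induction ps)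
    case (Cons q ps)
    obtain i j where q: "q = (i, j)" by force
    have ij: "i < N" "j < N"
      using Cons.prems q by auto
    have IH: "represents b N (foldr step ps id F) (foldr ?y ps p)"
      by (rule Cons.IH) (use Cons.prems in simp)
    show ?case
      using represents_yfactor[OF IH ij] by (simp only: q step foldr_Cons o_apply)
  qed (use assms in simp)
  then show ?thesis
    unfolding Yop_def step_def[symmetric] using set_index_pairs by blast
qed

section \<open>The scalar products as pairings of polynomials\<close>

lemma peval_V: "peval (V N) x = complex_of_real (vandermonde N x)"
proof -
  have "vandermonde N x = (\<Prod>(i, j)\<in>pairs N. x i - x j)"
    unfolding vandermonde_def pairs_def by (rule prod.Sigma) auto
  then show ?thesis by (simp add: V_def case_prod_unfold)
qed

lemma vandermonde_eq_0_iff: "vandermonde N x = 0 \<longleftrightarrow> \<not> inj_on x {..<N}"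
proof
  assume "\<not> inj_on x {..<N}"
  then obtain i j where "i < N" "j < N" "i \<noteq> j" "x i = x j"
    by (auto simp: inj_on_def)
  then have "\<exists>i j. i < j \<and> j < N \<and> x i = x j"
    by (metis nat_neq_iff)
  then show "vandermonde N x = 0"
    by (fastforce simp: vandermonde_def)
next
  assume "vandermonde N x = 0"
  then obtain i j where "i < j" "j < N" "x i = x j"
    by (auto simp: vandermonde_def)
  then show "\<not> inj_on x {..<N}"
    by (metis inj_on_eq_iff lessThan_iff less_trans nat_neq_iff)
qed

lemma phiA_sq:
  "complex_of_real ((phiA N \<beta> x)\<^sup>2) = peval (W N \<beta>) x * complex_of_real (gauss N x)"
proof -
  have "(\<Prod>j<N. \<Prod>k\<in>{j<..<N}. \<bar>x j - x k\<bar> ^ \<beta>) = \<bar>vandermonde N x\<bar> ^ \<beta>"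
    by (simp add: vandermonde_def abs_prod prod_power_distrib)
  moreover have "(\<Prod>j<N. exp (- (x j)\<^sup>2 / 2))\<^sup>2 = gauss N x"
    unfolding gauss_def prod_power_distrib
    by (intro prod.cong refl) (simp flip: exp_double)
  ultimately have "(phiA N \<beta> x)\<^sup>2 = vandermonde N x ^ (2 * \<beta>) * gauss N x"
    by (simp add: phiA_def power_mult_distrib power_mult power_even_abs flip: power_mult mult.commute[of 2])
  then show ?thesis by (simp add: W_def peval_V)
qed

lemma poly_fun_in_polys: "poly_fun N f \<Longrightarrow> f \<in> polys"
proof -
  assume "poly_fun N f"
  then obtain c :: "(nat \<Rightarrow> nat) \<Rightarrow> complex" where
    "\<And>x. f x = (\<Sum>\<alpha>\<in>{\<alpha>. c \<alpha> \<noteq> 0}. c \<alpha> * (\<Prod>i<N. complex_of_real (x i) ^ \<alpha> i))"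
    unfolding poly_fun_def by blast
  then have "f = (\<lambda>x. \<Sum>\<alpha>\<in>{\<alpha>. c \<alpha> \<noteq> 0}. c \<alpha> * (\<Prod>i<N. complex_of_real (x i) ^ \<alpha> i))"
    by blast
  also have "\<dots> \<in> polys"
    by (intro polys_sum polys.mult polys_prod polys_power polys.const polys.coord)
  finally show ?thesis .
qed

lemma sym_poly_obtain:
  assumes "sym_poly N f"
  obtains p where "f = peval p" "\<And>i j. i < N \<Longrightarrow> j < N \<Longrightarrow> S i j p = p"
proof
  have f: "f \<in> polys"
    using assms poly_fun_in_polys[of N f] by (simp add: sym_poly_def)
  then show "f = peval (Abs_cpoly f)" by (simp add: Abs_cpoly_inverse)
  fix i j assume ij: "i < N" "j < N"
  have "transpose i j permutes {..<N}"
    using ij by (simp add: permutes_swap_id)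
  then have "f (swapv i j x) = f x" for x
    using assms by (simp add: sym_poly_def swapv_eq_comp)
  then show "S i j (Abs_cpoly f) = Abs_cpoly f"
    using f by (intro cpoly_eqI) (simp add: Abs_cpoly_inverse)
qed

text \<open>Raising the parameter by one multiplies the weight by the squared Vandermonde product:
  one factor cancels the division, the other goes to \<open>q\<close>. Where the product vanishes
  both integrands are 0.\<close>

lemma ipH_GH:
  assumes "represents (real \<beta>) N F p"
  shows "ipH N (\<beta> + 1) (\<lambda>x. F x / complex_of_real (vandermonde N x)) (peval q) = ip N \<beta> p (V N * q)"
proof -
  have "F x / complex_of_real (vandermonde N x) * peval q x * complex_of_real ((phiA N (\<beta> + 1) x)\<^sup>2)
      = peval (p * (V N * q) * W N \<beta>) x * complex_of_real (gauss N x)" for x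
  proof (cases "vandermonde N x = 0")
    case False
    then have "F x = peval p x"
      using assms by (simp add: represents_def regular_def vandermonde_eq_0_iff)
    then show ?thesis
      unfolding phiA_sq using False by (simp add: W_def peval_V)
  qed (simp add: peval_V)
  then show ?thesis by (simp only: ipH_def ip_def E_def)
qed

lemma ipH_represents:
  assumes "represents (real \<beta>) N F p"
  shows "ipH N \<beta> (peval q) F = ip N \<beta> q p"
proof -
  have "peval q x * F x * complex_of_real ((phiA N \<beta> x)\<^sup>2)
      = peval (q * p * W N \<beta>) x * complex_of_real (gauss N x)" for x
  proof (cases "regular (real \<beta>) N x")
    case True
    then show ?thesis
      unfolding phiA_sq using representsD[OF assms] by simp
  next
    case False
    then have "peval (W N \<beta>) x = 0"
      by (simp add: regular_def W_def peval_V vandermonde_eq_0_iff)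
    then show ?thesis unfolding phiA_sq by simp
  qed
  then show ?thesis by (simp only: ipH_def ip_def E_def)
qed

theorem theorem4p6:
  fixes N \<beta> :: nat and f g :: rfun
  assumes "N \<ge> 1" and "sym_poly N f" and "sym_poly N g"
  shows "ipH N (\<beta> + 1) (GH N (real \<beta>) f) g = ipH N \<beta> f (GHhat N (real \<beta>) g)"
proof -
  obtain p where f: "f = peval p" and p: "\<And>i j. i < N \<Longrightarrow> j < N \<Longrightarrow> S i j p = p"
    using sym_poly_obtain[OF assms(2)] by blast
  obtain q where g: "g = peval q" and q: "\<And>i j. i < N \<Longrightarrow> j < N \<Longrightarrow> S i j q = q"
    using sym_poly_obtain[OF assms(3)] by blast
  let ?b = "real \<beta>" and ?y = "\<lambda>c. foldr (yC N (of_nat \<beta>) c) (index_pairs N)"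
  have "represents ?b N (Yop N ?b ?b f) (?y (complex_of_real ?b) p)"
    using represents_Yop[of ?b N f p ?b] by (simp add: represents_def f)
  then have "ipH N (\<beta> + 1) (GH N ?b f) g = ip N \<beta> (?y (complex_of_real ?b) p) (V N * q)"
    unfolding g GH_def by (rule ipH_GH)
  \<comment> \<open>The constant changes from \<open>\<beta>\<close> to \<open>- \<beta>\<close>
    while the order of the factors stays. The factor \<open>V N\<close> makes the right argument
    antisymmetric, and the list of pairs has exactly the length allowed by the comparison
    lemma.\<close>
  also have "\<dots> = ip N \<beta> p (?y (complex_of_real (- ?b)) (V N * q))"
  proof (rule ip_yC_prod_sym_antisym)
    show "antisymmetric N (V N * q)"
      by unfold_locales (simp add: S_V q)
  qed (use p set_index_pairs length_index_pairs in auto)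
  also have "\<dots> = ipH N \<beta> f (GHhat N ?b g)"
  proof -
    have "represents ?b N (GHhat N ?b g) (?y (complex_of_real (- ?b)) (V N * q))"
      using represents_Yop[of ?b N "\<lambda>x. complex_of_real (vandermonde N x) * g x" "V N * q" "- ?b"]
      by (simp add: represents_def GHhat_def g peval_V)
    then show ?thesis unfolding f by (rule ipH_represents[symmetric])
  qed
  finally show ?thesis .
qed

end
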